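(* Let $(R,\mathfrak{m}_R,k)$ be an equicharacteristic one-dimensional complete local domain over an algebraically closed field $k$ of characteristic $0$. Let $x$ be a minimal reduction of $\mathfrak{m}_R$, let $\mathfrak{C}_R$ be the conductor ideal of $R$ in its integral closure, let $n$ be the embedding dimension of $R$, and let $s(R)=\dim_k \frac{(\mathfrak{C}_R,x)}{(x)}$ be the reduced type of $R$. Then Berger's conjecture is true for $R$ (that is, $R$ is regular if and only if $\tau(\Omega_R)=0$) in each of the following cases: (1) $\mathfrak{m}_R^4\subseteq (\mathfrak{C}_R,x)$ and $2\,s(R)\leq n(n-3)$; (2) $\mathfrak{m}_R^6\subseteq (x)$, $n\geq 6$ and $R$ is Gorenstein.
   Context: $R$ is a $k$-algebra with residue field $k$. Its integral closure in its fraction field $Q$ is denoted $\overline{R}$; one has $\overline{R}=k[[t]]$ for a uniformizing parameter $t$. The embedding dimension $n$ of $R$ is the minimal number of generators of $\mathfrak{m}_R$. The conductor is $\mathfrak{C}_R=\{q\in Q: q\overline{R}\subseteq R\}$, the largest common ideal of $R$ and $\overline{R}$. An element $x\in\mathfrak{m}_R$ is called a minimal reduction of $\mathfrak{m}_R$ if the ideal $(x)$ is a minimal reduction, i.e. $x\mathfrak{m}_R^{r}=\mathfrak{m}_R^{r+1}$ for some $r\ge 0$. Write $R=k[[X_1,\dots,X_n]]/I$ with $I=(f_1,\dots,f_m)\subseteq (X_1,\dots,X_n)^2$, and let $x_i$ be the image of $X_i$. The universally finite module of differentials $\Omega_R$ of $R$ over $k$ is the cokernel of the Jacobian matrix $R^m\xrightarrow{[\partial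 f_j/\partial x_i]}R^n$ (entries in $R$), with the images of the standard basis vectors denoted $dx_1,\dots,dx_n$. Its torsion submodule (elements annihilated by a nonzero element of $R$) is denoted $\tau(\Omega_R)$. *)

theory Defs
  imports
    "HOL-Analysis.Analysis"
    "HOL-Computational_Algebra.Polynomial_Factorial"
    "HOL-Library.Set_Algebras"
    "HOL-Library.Extended_Nat"
begin

section \<open>Ideals of a commutative ring\<close>

text \<open>A ring is a module over itself: its ideals are the submodules, and the ideal generated
  by a set is its span.\<close>

lemma module_ring: "module ((*) :: 'a::comm_ring_1 \<Rightarrow> 'a \<Rightarrow> 'a)"
  by standard (simp_all add: algebra_simps)

abbreviation is_ideal :: "'a::comm_ring_1 set \<Rightarrow> bool" where
  "is_ideal \<equiv> module.subspace (*)"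

abbreviation ideal_gen :: "'a::comm_ring_1 set \<Rightarrow> 'a set" where
  "ideal_gen \<equiv> module.span (*)"

definition ideal_mult :: "'a::comm_ring_1 set \<Rightarrow> 'a set \<Rightarrow> 'a set" where
  "ideal_mult I J = ideal_gen {a * b | a b. a \<in> I \<and> b \<in> J}"

primrec ideal_power :: "'a::comm_ring_1 set \<Rightarrow> nat \<Rightarrow> 'a set" where
  "ideal_power I 0 = UNIV"
| "ideal_power I (Suc r) = ideal_mult I (ideal_power I r)"

definition prime_ideal :: "'a::comm_ring_1 set \<Rightarrow> bool" where
  "prime_ideal P \<longleftrightarrow> is_ideal P \<and> P \<noteq> UNIV \<and> (\<forall>a b. a * b \<in> P \<longrightarrow> a \<in> P \<or> b \<in> P)"

definition maximal_ideal :: "'a::comm_ring_1 set \<Rightarrow> bool" where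
  "maximal_ideal M \<longleftrightarrow> is_ideal M \<and> M \<noteq> UNIV \<and>
     (\<forall>J. is_ideal J \<and> M \<subseteq> J \<longrightarrow> J = M \<or> J = UNIV)"

text \<open>The ring under consideration is a whole type, so properties of the ring itself take a
  type token as argument.\<close>

definition noetherian_ring :: "'a::comm_ring_1 itself \<Rightarrow> bool" where
  "noetherian_ring _ \<longleftrightarrow>
     (\<forall>I :: 'a set. is_ideal I \<longrightarrow> (\<exists>S. finite S \<and> I = ideal_gen S))"

definition krull_dim :: "'a::comm_ring_1 itself \<Rightarrow> enat" where
  "krull_dim _ = (SUP d \<in> {d. \<exists>P :: nat \<Rightarrow> 'a set.
      (\<forall>i\<le>d. prime_ideal (P i)) \<and> (\<forall>i<d. P i \<subset> P (Suc i))}. enat d)"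


section \<open>Complete local algebras with a coefficient field\<close>

definition ring_homomorphism :: "('a::comm_ring_1 \<Rightarrow> 'b::comm_ring_1) \<Rightarrow> bool" where
  "ring_homomorphism h \<longleftrightarrow> h 1 = 1 \<and> (\<forall>a b. h (a + b) = h a + h b) \<and>
     (\<forall>a b. h (a * b) = h a * h b)"

definition local_ring :: "'a::comm_ring_1 set \<Rightarrow> bool" where
  "local_ring m \<longleftrightarrow> (\<forall>M. maximal_ideal M \<longleftrightarrow> M = m)"

text \<open>The composite of the structure map with the projection modulo \<open>m\<close> is bijective.\<close>

definition residue_field_is :: "('k::field \<Rightarrow> 'a::comm_ring_1) \<Rightarrow> 'a set \<Rightarrow> bool" where
  "residue_field_is \<iota> m \<longleftrightarrow> (\<forall>r. \<exists>!c. r - \<iota> c \<in> m)"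

text \<open>The canonical map from the ring to the inverse limit of its quotients by the powers of
  \<open>m\<close> is bijective: the first conjunct is injectivity, the second is surjectivity, where a
  compatible system of residue classes is given by representatives \<open>s i\<close>.\<close>

definition adically_complete :: "'a::comm_ring_1 set \<Rightarrow> bool" where
  "adically_complete m \<longleftrightarrow> (\<Inter>i. ideal_power m i) = {0} \<and>
     (\<forall>s :: nat \<Rightarrow> 'a. (\<forall>i. s (Suc i) - s i \<in> ideal_power m i) \<longrightarrow>
        (\<exists>l. \<forall>i. l - s i \<in> ideal_power m i))"

definition embedding_dim :: "'a::comm_ring_1 set \<Rightarrow> nat" where
  "embedding_dim m = (LEAST n. \<exists>S. finite S \<and> card S = n \<and> ideal_gen S = m)"

definition regular_local_ring :: "'a::comm_ring_1 set \<Rightarrow> bool" where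
  "regular_local_ring m \<longleftrightarrow> enat (embedding_dim m) = krull_dim TYPE('a)"

definition minimal_reduction :: "'a::comm_ring_1 \<Rightarrow> 'a set \<Rightarrow> bool" where
  "minimal_reduction x m \<longleftrightarrow> x \<in> m \<and>
     (\<exists>r. (*) x ` ideal_power m r = ideal_power m (Suc r))"


section \<open>Integral closure and conductor\<close>

definition integral_closure :: "'a::idom fract set" where
  "integral_closure =
     {q. \<exists>p :: 'a poly. lead_coeff p = 1 \<and> poly (map_poly to_fract p) q = 0}"

definition conductor :: "'a::idom fract set" where
  "conductor = {q. \<forall>y \<in> integral_closure. q * y \<in> range to_fract}"

text \<open>Since \<open>1\<close> is integral, the conductor lies in the image of the ring in its fraction
  field; this is the same ideal, regarded as a subset of the ring.\<close>

definition conductor_ideal :: "'a::idom set" where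
  "conductor_ideal = to_fract -` conductor"


section \<open>Vector space dimension of quotients, reduced type, Gorenstein rings\<close>

text \<open>For subspaces \<open>W \<subseteq> V\<close>, \<open>quotient_basis sc V W B\<close> says that \<open>B\<close> is mapped injectively
  onto a basis of \<open>V/W\<close>.\<close>

definition quotient_basis ::
    "('k::field \<Rightarrow> 'v::ab_group_add \<Rightarrow> 'v) \<Rightarrow> 'v set \<Rightarrow> 'v set \<Rightarrow> 'v set \<Rightarrow> bool" where
  "quotient_basis sc V W B \<longleftrightarrow> B \<subseteq> V \<and>
     (\<forall>b\<in>B. b \<notin> module.span sc (W \<union> (B - {b}))) \<and> V \<subseteq> module.span sc (W \<union> B)"

definition quotient_dim ::
    "('k::field \<Rightarrow> 'v::ab_group_add \<Rightarrow> 'v) \<Rightarrow> 'v set \<Rightarrow> 'v set \<Rightarrow> nat" where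
  "quotient_dim sc V W = card (SOME B. quotient_basis sc V W B)"

definition alg_scale :: "('k::field \<Rightarrow> 'a::comm_ring_1) \<Rightarrow> 'k \<Rightarrow> 'a \<Rightarrow> 'a" where
  "alg_scale \<iota> c r = \<iota> c * r"

definition reduced_type :: "('k::field \<Rightarrow> 'a::idom) \<Rightarrow> 'a \<Rightarrow> nat" where
  "reduced_type \<iota> x =
     quotient_dim (alg_scale \<iota>) (ideal_gen (insert x conductor_ideal)) (ideal_gen {x})"

text \<open>A one-dimensional Noetherian local domain is Cohen-Macaulay, every nonzero \<open>y \<in> m\<close> being
  a maximal regular sequence. Its type is the dimension of the socle
  \<open>((y) : m) / (y)\<close> of the quotient by \<open>(y)\<close>, which does not depend on \<open>y\<close>, and the ring is Gorenstein
  if it has type \<open>1\<close>. The definition below is meant for such rings only, with residue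
  field the domain of \<open>\<iota>\<close>.\<close>

definition cm_type :: "('k::field \<Rightarrow> 'a::idom) \<Rightarrow> 'a set \<Rightarrow> 'a \<Rightarrow> nat" where
  "cm_type \<iota> m y =
     quotient_dim (alg_scale \<iota>) {r. \<forall>a\<in>m. a * r \<in> ideal_gen {y}} (ideal_gen {y})"

definition gorenstein :: "('k::field \<Rightarrow> 'a::idom) \<Rightarrow> 'a set \<Rightarrow> bool" where
  "gorenstein \<iota> m \<longleftrightarrow> (\<exists>y\<in>m. y \<noteq> 0 \<and> cm_type \<iota> m y = 1)"


section \<open>Formal power series in several variables\<close>

text \<open>The variables are indexed by the finite type \<open>'n\<close>, so that multi-indices are the vectors
  \<open>nat ^ 'n\<close>.\<close>

typedef (overloaded) ('k, 'n::finite) mfps = "UNIV :: (nat ^ 'n \<Rightarrow> 'k) set"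
  morphisms mfps_coeff Abs_mfps
  by simp

lemma mfps_coeff_Abs [simp]: "mfps_coeff (Abs_mfps g) = g"
  by (simp add: Abs_mfps_inverse)

lemma mfps_eqI: "(\<And>e. mfps_coeff p e = mfps_coeff q e) \<Longrightarrow> p = q"
  by (metis mfps_coeff_inject ext)

lemma finite_splittings: "finite {(a, b :: nat ^ 'n::finite). a + b = e}"
proof -
  have fin: "finite {a :: nat ^ 'n. \<forall>i. a $ i \<le> e $ i}"
  proof (rule finite_subset)
    show "finite (vec_lambda ` (\<Pi>\<^sub>E i\<in>UNIV. {..e $ i}))"
      by (intro finite_imageI finite_PiE) auto
    show "{a. \<forall>i. a $ i \<le> e $ i} \<subseteq> vec_lambda ` (\<Pi>\<^sub>E i\<in>UNIV. {..e $ i})"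
    proof
      fix a :: "nat ^ 'n" assume "a \<in> {a. \<forall>i. a $ i \<le> e $ i}"
      then show "a \<in> vec_lambda ` (\<Pi>\<^sub>E i\<in>UNIV. {..e $ i})"
        by (intro image_eqI[of _ _ "($) a"]) auto
    qed
  qed
  show ?thesis
    by (rule finite_subset[OF _ finite_cartesian_product[OF fin fin]]) auto
qed

lemma sum_splittings_assoc:
  fixes P Q R :: "'e::comm_monoid_add \<Rightarrow> 'a::comm_ring_1"
  shows "(\<Sum>(x, y) \<in> Sigma {(a, b). a + b = e} (\<lambda>x. {(a, b). a + b = fst x}).
          P (fst y) * Q (snd y) * R (snd x)) =
         (\<Sum>(x, y) \<in> Sigma {(a, b). a + b = e} (\<lambda>x. {(a, b). a + b = snd x}).
          P (fst x) * (Q (fst y) * R (snd y)))"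
  by (rule sum.reindex_bij_witness
          [where i="\<lambda>z. ((fst (fst z) + fst (snd z), snd (snd z)), (fst (fst z), fst (snd z)))"
             and j="\<lambda>z. ((fst (snd z), snd (snd z) + snd (fst z)), (snd (snd z), snd (fst z)))"])
    (auto simp: add.assoc mult.assoc)

instantiation mfps :: (comm_ring_1, finite) comm_ring_1
begin

definition "0 = Abs_mfps (\<lambda>_. 0)"
definition "1 = Abs_mfps (\<lambda>e. if e = 0 then 1 else 0)"
definition "p + q = Abs_mfps (\<lambda>e. mfps_coeff p e + mfps_coeff q e)"
definition "- p = Abs_mfps (\<lambda>e. - mfps_coeff p e)"
definition "p - q = Abs_mfps (\<lambda>e. mfps_coeff p e - mfps_coeff q e)"
definition "p * q = Abs_mfps (\<lambda>e. \<Sum>(a, b) | a + b = e. mfps_coeff p a * mfps_coeff q b)"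

instance
proof
  fix p q r :: "('a, 'b) mfps"
  show "p + q + r = p + (q + r)" "p + q = q + p" "0 + p = p" "- p + p = 0" "p - q = p + - q"
    by (simp_all add: plus_mfps_def zero_mfps_def uminus_mfps_def minus_mfps_def algebra_simps
        mfps_coeff_inverse)
  show "(0::('a, 'b) mfps) \<noteq> 1"
    by (metis (mono_tags, lifting) mfps_coeff_Abs one_mfps_def zero_mfps_def zero_neq_one)
  show "p * q = q * p"
  proof (rule mfps_eqI)
    fix e
    show "mfps_coeff (p * q) e = mfps_coeff (q * p) e"
      unfolding times_mfps_def mfps_coeff_Abs
      by (rule sum.reindex_bij_witness[where i=prod.swap and j=prod.swap])
        (auto simp: add.commute mult.commute)
  qed
  show "1 * p = p"
  proof (rule mfps_eqI)
    fix e
    have "mfps_coeff (1 * p) e =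
        (\<Sum>(a :: nat ^ 'b, b) | a + b = e. if a = 0 then mfps_coeff p b else 0)"
      unfolding times_mfps_def one_mfps_def mfps_coeff_Abs
      by (intro sum.cong) (auto simp: mult_ac)
    also have "\<dots> = (\<Sum>(a :: nat ^ 'b, b) \<in> {(0, e)}. if a = 0 then mfps_coeff p b else 0)"
      by (intro sum.mono_neutral_right finite_splittings) (auto split: if_splits)
    finally show "mfps_coeff (1 * p) e = mfps_coeff p e" by simp
  qed
  show "(p + q) * r = p * r + q * r"
    by (rule mfps_eqI) (simp add: times_mfps_def plus_mfps_def case_prod_unfold
        distrib_right sum.distrib)
  show "p * q * r = p * (q * r)"
  proof (rule mfps_eqI)
    fix e
    let ?S = "\<lambda>e. {(a, b :: nat ^ 'b). a + b = e}"
    have fin: "finite (?S e)" for e by (rule finite_splittings)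
    have "mfps_coeff (p * q * r) e = (\<Sum>x \<in> ?S e. \<Sum>y \<in> ?S (fst x).
        mfps_coeff p (fst y) * mfps_coeff q (snd y) * mfps_coeff r (snd x))"
      by (simp add: times_mfps_def case_prod_unfold sum_distrib_right)
    also have "\<dots> = (\<Sum>(x, y) \<in> Sigma (?S e) (\<lambda>x. ?S (fst x)).
        mfps_coeff p (fst y) * mfps_coeff q (snd y) * mfps_coeff r (snd x))"
      by (intro sum.Sigma ballI fin)
    also have "\<dots> = (\<Sum>(x, y) \<in> Sigma (?S e) (\<lambda>x. ?S (snd x)).
        mfps_coeff p (fst x) * (mfps_coeff q (fst y) * mfps_coeff r (snd y)))"
      by (rule sum_splittings_assoc)
    also have "\<dots> = (\<Sum>x \<in> ?S e. \<Sum>y \<in> ?S (snd x).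
        mfps_coeff p (fst x) * (mfps_coeff q (fst y) * mfps_coeff r (snd y)))"
      by (intro sum.Sigma[symmetric] ballI fin)
    also have "\<dots> = mfps_coeff (p * (q * r)) e"
      by (simp add: times_mfps_def case_prod_unfold sum_distrib_left)
    finally show "mfps_coeff (p * q * r) e = mfps_coeff (p * (q * r)) e" .
  qed
qed

end

definition mfps_const :: "'k::comm_ring_1 \<Rightarrow> ('k, 'n::finite) mfps" where
  "mfps_const c = Abs_mfps (\<lambda>e. if e = 0 then c else 0)"

definition mfps_var :: "'n::finite \<Rightarrow> ('k::comm_ring_1, 'n) mfps" where
  "mfps_var i = Abs_mfps (\<lambda>e. if e = axis i 1 then 1 else 0)"

definition mfps_pderiv :: "'n::finite \<Rightarrow> ('k::comm_ring_1, 'n) mfps \<Rightarrow> ('k, 'n) mfps" where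
  "mfps_pderiv i p = Abs_mfps (\<lambda>e. of_nat (e $ i + 1) * mfps_coeff p (e + axis i 1))"


section \<open>Universally finite differentials and their torsion\<close>

text \<open>\<open>presentation \<iota> \<phi> f\<close>: the map \<open>\<phi>\<close> is a surjective homomorphism of \<open>k\<close>-algebras from the
  power series ring to the ring, with kernel generated by the entries of \<open>f\<close> and contained in the
  square of the ideal of the variables. A regular ring is presented by \<open>f = 0\<close>.\<close>

definition presentation :: "('k::field \<Rightarrow> 'a::comm_ring_1) \<Rightarrow>
    (('k, 'n::finite) mfps \<Rightarrow> 'a) \<Rightarrow> ('k, 'n) mfps ^ 'm::finite \<Rightarrow> bool" where
  "presentation \<iota> \<phi> f \<longleftrightarrow> ring_homomorphism \<phi> \<and> (\<forall>c. \<phi> (mfps_const c) = \<iota> c) \<and> surj \<phi> \<and>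
     {p. \<phi> p = 0} = ideal_gen (range (($) f)) \<and>
     ideal_gen (range (($) f)) \<subseteq> ideal_power (ideal_gen (range mfps_var)) 2"

definition jacobian_matrix :: "(('k::field, 'n::finite) mfps \<Rightarrow> 'a::comm_ring_1) \<Rightarrow>
    ('k, 'n) mfps ^ 'm::finite \<Rightarrow> 'a ^ 'm ^ 'n" where
  "jacobian_matrix \<phi> f = (\<chi> i j. \<phi> (mfps_pderiv i (f $ j)))"

text \<open>The elements of the cokernel of \<open>A\<close> are the cosets of the image of \<open>A\<close>; the image itself is
  the zero element.\<close>

definition coker :: "'a::comm_ring_1 ^ 'm::finite ^ 'n::finite \<Rightarrow> ('a ^ 'n) set set" where
  "coker A = {v +o range ((*v) A) | v. True}"

definition coker_zero :: "'a::comm_ring_1 ^ 'm::finite ^ 'n::finite \<Rightarrow> ('a ^ 'n) set" where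
  "coker_zero A = range ((*v) A)"

definition coker_scale ::
    "'a::comm_ring_1 ^ 'm::finite ^ 'n::finite \<Rightarrow> 'a \<Rightarrow> ('a ^ 'n) set \<Rightarrow> ('a ^ 'n) set" where
  "coker_scale A r w = (\<Union>v\<in>w. (r *s v) +o range ((*v) A))"

definition coker_torsion :: "'a::idom ^ 'm::finite ^ 'n::finite \<Rightarrow> ('a ^ 'n) set set" where
  "coker_torsion A = {w \<in> coker A. \<exists>r. r \<noteq> 0 \<and> coker_scale A r w = coker_zero A}"

text \<open>The torsion submodule of the cokernel of the Jacobian matrix. The proposition in Berger's
  conjecture is that the ring is regular if and only if this submodule is zero.\<close>

definition differentials_torsion :: "(('k::field, 'n::finite) mfps \<Rightarrow> 'a::idom) \<Rightarrow>
    ('k, 'n) mfps ^ 'm::finite \<Rightarrow> ('a ^ 'n) set set" where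
  "differentials_torsion \<phi> f = coker_torsion (jacobian_matrix \<phi> f)"

definition berger_conjecture :: "'a::idom set \<Rightarrow> (('k::field, 'n::finite) mfps \<Rightarrow> 'a) \<Rightarrow>
    ('k, 'n) mfps ^ 'm::finite \<Rightarrow> bool" where
  "berger_conjecture m \<phi> f \<longleftrightarrow>
     (regular_local_ring m \<longleftrightarrow>
        differentials_torsion \<phi> f = {coker_zero (jacobian_matrix \<phi> f)})"

end

theory Submission
  imports Defs
begin

text \<open>
  Let \<open>P\<close> be the power series ring, \<open>J\<close> the Jacobian matrix and \<open>N\<close> its image, so that the module of
  differentials is \<open>\<Omega> = R\<^sup>n/N\<close>. It has rank one, because a derivation of \<open>R\<close> that kills \<open>x\<close> kills \<open>k[[x]]\<close>,
  over which \<open>R\<close> is algebraic. Hence, if \<open>\<Omega>\<close> is torsion-free, \<open>\<Omega>/x\<Omega>\<close> has at most the dimension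
  \<open>e\<close> of \<open>R/(x)\<close>.

  On the other hand, let \<open>W\<close> be a subspace of dimension \<open>s\<close> modulo \<open>(x)\<close> that contains \<open>x\<close> and \<open>m\<^sup>4\<close>. The
  following elements of \<open>\<Omega>/x\<Omega>\<close> are linearly independent: \<open>dx\<close>; the differentials \<open>dr\<close>, where \<open>r\<close> runs through
  at least \<open>e - s - 1\<close> elements independent modulo \<open>W + k\<close>; and \<open>x\<^sub>b dx\<^sub>a\<close> for the pairs \<open>a < b\<close> taken from
  \<open>n - 1\<close> of the variables that together with \<open>x\<close> generate \<open>m\<close>. The last
  ones are separated from the exact differentials by their curl, and the differentials from \<open>0\<close> by
  the Euler relation, which determines an element of order three up to \<open>m\<^sup>4\<close>. So \<open>\<Omega>\<close>
  has torsion as soon as \<open>s + 1\<close> is at most the number \<open>(n - 1)(n - 2)/2\<close> of these pairs.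

  In the first case \<open>W\<close> is the ideal generated by \<open>x\<close> and the conductor. In the second case it is
  \<open>(x) : m\<^sup>2\<close>, of dimension at most \<open>n + 1\<close> modulo \<open>(x)\<close> because the socle of \<open>R/(x)\<close> is one-dimensional.
\<close>

section \<open>Coefficients and orders of power series\<close>

lemma coeff_simps [simp]:
  "mfps_coeff 0 e = 0"
  "mfps_coeff 1 e = (if e = 0 then 1 else 0)"
  "mfps_coeff (p + q) e = mfps_coeff p e + mfps_coeff q e"
  "mfps_coeff (p - q) e = mfps_coeff p e - mfps_coeff q e"
  "mfps_coeff (- p) e = - mfps_coeff p e"
  "mfps_coeff (mfps_pderiv i p) e = of_nat (e $ i + 1) * mfps_coeff p (e + axis i 1)"
  "mfps_coeff (mfps_const c) e = (if e = 0 then c else 0)"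
  "mfps_coeff (mfps_var i) e = (if e = axis i 1 then 1 else 0)"
  by (simp_all add: plus_mfps_def zero_mfps_def one_mfps_def uminus_mfps_def minus_mfps_def
      mfps_pderiv_def mfps_const_def mfps_var_def)

lemma coeff_sum [simp]: "mfps_coeff (sum g A) e = (\<Sum>a\<in>A. mfps_coeff (g a) e)"
  by (induction A rule: infinite_finite_induct) auto

lemma coeff_mult: "mfps_coeff (p * q) e = (\<Sum>(a, b) | a + b = e. mfps_coeff p a * mfps_coeff q b)"
  by (simp add: times_mfps_def)

lemma mindex_add_eq_0_iff: "a + b = (0 :: nat ^ 'n::finite) \<longleftrightarrow> a = 0 \<and> b = 0"
  by (auto simp: vec_eq_iff)

lemma coeff_mult_0 [simp]: "mfps_coeff (p * q) 0 = mfps_coeff p 0 * mfps_coeff q 0"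
proof -
  have "{(a, b :: nat ^ 'b). a + b = 0} = {(0, 0)}" by (auto simp: mindex_add_eq_0_iff)
  then show ?thesis by (simp add: coeff_mult)
qed

lemma coeff_var_0 [simp]: "mfps_coeff (mfps_var i) 0 = 0"
  by (simp add: vec_eq_iff axis_def)

lemma coeff_const_mult [simp]: "mfps_coeff (mfps_const c * p) e = c * mfps_coeff p e"
proof -
  have "mfps_coeff (mfps_const c * p) e =
      (\<Sum>(a, b) \<in> {(0 :: nat ^ 'b, e)}. mfps_coeff (mfps_const c) a * mfps_coeff p b)"
    unfolding coeff_mult
    by (intro sum.mono_neutral_right finite_splittings) (auto split: if_splits)
  then show ?thesis by simp
qed

lemma coeff_var_mult: "mfps_coeff (mfps_var i * p) (axis i 1 + e) = mfps_coeff p e"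
proof -
  have "mfps_coeff (mfps_var i * p) (axis i 1 + e) =
      (\<Sum>(a, b) \<in> {(axis i 1 :: nat ^ 'b, e)}. mfps_coeff (mfps_var i) a * mfps_coeff p b)"
    unfolding coeff_mult
    by (intro sum.mono_neutral_right finite_splittings) (auto split: if_splits)
  then show ?thesis by simp
qed

lemmas coeff_var_mult_Suc [simp] = coeff_var_mult[unfolded One_nat_def]

lemma coeff_var_mult_0: "e $ i = 0 \<Longrightarrow> mfps_coeff (mfps_var i * p) e = 0"
  unfolding coeff_mult by (intro sum.neutral) (auto simp: axis_def)

lemma mindex_split: "e $ i > 0 \<Longrightarrow> \<exists>e'. e = axis i 1 + (e' :: nat ^ 'n::finite)"
  by (rule exI[of _ "\<chi> j. e $ j - (axis i 1 :: nat ^ 'n) $ j"]) (auto simp: vec_eq_iff axis_def)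

text \<open>Summed over \<open>i\<close>, the exponents add up to the total degree; this yields the
  Euler relation of \<open>Euler_order\<close>.\<close>

lemma coeff_Euler: "mfps_coeff (mfps_var i * mfps_pderiv i p) e = of_nat (e $ i) * mfps_coeff p e"
proof (cases "e $ i = 0")
  case False
  then obtain e' where e: "e = axis i 1 + e'" using mindex_split by blast
  have "(axis i 1 + e') $ i = e' $ i + 1" by (simp add: axis_def)
  then show ?thesis unfolding e coeff_var_mult by (simp only: coeff_simps add.commute)
qed (simp add: coeff_var_mult_0)

text \<open>At a splitting \<open>a + b = e + ?u\<close> the exponent factor is
  \<open>a $ i + b $ i\<close>; its two summands give the two terms of the product rule.\<close>

lemma pderiv_mult: "mfps_pderiv i (p * q) = p * mfps_pderiv i q + q * mfps_pderiv i p"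
proof (rule mfps_eqI)
  fix e :: "nat ^ 'b"
  let ?u = "axis i 1 :: nat ^ 'b"
  \<comment> \<open>Shifting \<open>b\<close> down by \<open>?u\<close> is possible when
    \<open>b $ i\<close> is positive; the other splittings carry the factor
    \<open>0\<close>.\<close>
  have half: "(\<Sum>(a, b) | a + b = e + ?u. of_nat (b $ i) * (mfps_coeff p a * mfps_coeff q b)) =
      mfps_coeff (p * mfps_pderiv i q) e" for p q :: "('a, 'b) mfps"
  proof -
    have "(\<Sum>(a, b) | a + b = e + ?u. of_nat (b $ i) * (mfps_coeff p a * mfps_coeff q b)) =
        (\<Sum>(a, b) \<in> (\<lambda>(a, b). (a, b + ?u)) ` {(a, b). a + b = e}.
          of_nat (b $ i) * (mfps_coeff p a * mfps_coeff q b))"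
    proof (intro sum.mono_neutral_right finite_splittings)
      show "\<forall>s\<in>{(a, b). a + b = e + ?u} - (\<lambda>(a, b). (a, b + ?u)) ` {(a, b). a + b = e}.
          (case s of (a, b) \<Rightarrow> of_nat (b $ i) * (mfps_coeff p a * mfps_coeff q b)) = 0"
      proof safe
        fix a b :: "nat ^ 'b"
        assume ab: "a + b = e + ?u" and n: "(a, b) \<notin> (\<lambda>(a, b). (a, b + ?u)) ` {(a, b). a + b = e}"
        have "b $ i = 0"
        proof (rule ccontr)
          assume "b $ i \<noteq> 0"
          then obtain b' where b: "b = ?u + b'" using mindex_split by blast
          with ab have "a + b' = e"
            by (metis add.commute add.left_commute add_left_cancel)
          with b have "(a, b) = (\<lambda>(a, b). (a, b + ?u)) (a, b')" "(a, b') \<in> {(a, b). a + b = e}"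
            by (auto simp: add.commute)
          with n show False by blast
        qed
        then show "of_nat (b $ i) * (mfps_coeff p a * mfps_coeff q b) = 0" by simp
      qed
    qed (auto simp: add.assoc[symmetric])
    also have "\<dots> = (\<Sum>(a, b) | a + b = e.
        of_nat ((b + ?u) $ i) * (mfps_coeff p a * mfps_coeff q (b + ?u)))"
      by (subst sum.reindex) (auto simp: inj_on_def case_prod_unfold)
    also have "\<dots> = mfps_coeff (p * mfps_pderiv i q) e"
      unfolding coeff_mult by (intro sum.cong) (auto simp: axis_def algebra_simps)
    finally show ?thesis .
  qed
  have "mfps_coeff (mfps_pderiv i (p * q)) e =
      (\<Sum>(a, b) | a + b = e + ?u. of_nat ((a + b) $ i) * (mfps_coeff p a * mfps_coeff q b))"
  proof -
    have "(a + b) $ i = e $ i + 1" if "a + b = e + ?u" for a b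
      using that by (simp add: axis_def)
    then show ?thesis
      by (simp only: coeff_simps coeff_mult sum_distrib_left case_prod_unfold)
        (intro sum.cong refl, clarsimp)
  qed
  also have "\<dots> =
      (\<Sum>(a, b) | a + b = e + ?u. of_nat (b $ i) * (mfps_coeff p a * mfps_coeff q b)) +
      (\<Sum>(a, b) | a + b = e + ?u. of_nat (a $ i) * (mfps_coeff p a * mfps_coeff q b))"
    by (simp add: case_prod_unfold sum.distrib[symmetric] algebra_simps)
  also have "(\<Sum>(a, b) | a + b = e + ?u. of_nat (a $ i) * (mfps_coeff p a * mfps_coeff q b)) =
      (\<Sum>(a, b) | a + b = e + ?u. of_nat (b $ i) * (mfps_coeff q a * mfps_coeff p b))"
    by (rule sum.reindex_bij_witness[where i=prod.swap and j=prod.swap])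
      (auto simp: add.commute mult.commute)
  finally show "mfps_coeff (mfps_pderiv i (p * q)) e =
      mfps_coeff (p * mfps_pderiv i q + q * mfps_pderiv i p) e"
    by (simp only: half coeff_simps)
qed

lemma pderiv_simps [simp]:
  "mfps_pderiv i (p + q) = mfps_pderiv i p + mfps_pderiv i q"
  "mfps_pderiv i (p - q) = mfps_pderiv i p - mfps_pderiv i q"
  "mfps_pderiv i 0 = 0"
  "mfps_pderiv i (mfps_const c) = 0"
  by (auto intro!: mfps_eqI simp: algebra_simps vec_eq_iff axis_def)

lemma pderiv_const_mult [simp]: "mfps_pderiv i (mfps_const c * p) = mfps_const c * mfps_pderiv i p"
  by (simp add: pderiv_mult)

lemma pderiv_sum: "mfps_pderiv i (sum g A) = (\<Sum>a\<in>A. mfps_pderiv i (g a))"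
  by (induction A rule: infinite_finite_induct) auto

lemma pderiv_var: "mfps_pderiv i (mfps_var j) = (if i = j then 1 else 0)"
  by (rule mfps_eqI) (auto simp: vec_eq_iff axis_def split: if_splits)

lemma pderiv_commute: "mfps_pderiv i (mfps_pderiv j p) = mfps_pderiv j (mfps_pderiv i p)"
  by (rule mfps_eqI, cases "i = j") (auto simp: axis_def algebra_simps)

lemma const_simps:
  "mfps_const (a + b) = mfps_const a + mfps_const b"
  "mfps_const (a * b) = mfps_const a * mfps_const b"
  "mfps_const 0 = 0"
  "mfps_const 1 = 1"
  by (auto intro!: mfps_eqI)

section \<open>Total degree and the filtration by order\<close>

definition mdeg :: "nat ^ 'n::finite \<Rightarrow> nat" where
  "mdeg e = (\<Sum>i\<in>UNIV. e $ i)"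

lemma mdeg_add [simp]: "mdeg (a + b) = mdeg a + mdeg b"
  by (simp add: mdeg_def sum.distrib)

lemma mdeg_axis [simp]: "mdeg (axis i c) = c"
  by (simp add: mdeg_def axis_def)

lemma mdeg_0 [simp]: "mdeg 0 = 0"
  by (simp add: mdeg_def)

lemma mdeg_eq_0_iff [simp]: "mdeg e = 0 \<longleftrightarrow> e = 0"
  by (auto simp: mdeg_def vec_eq_iff)

lemma mindex_cases: obtains "e = 0" | i e' where "e = axis i 1 + (e' :: nat ^ 'n::finite)"
proof (cases "e = 0")
  case False
  then obtain i where "e $ i > 0" by (auto simp: vec_eq_iff)
  then show ?thesis using mindex_split that by blast
qed (use that in blast)

text \<open>This is the \<open>N\<close>-th power of the ideal of the variables, encoded by
  coefficients so that membership can be tested degree by degree.\<close>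

definition order_ge :: "nat \<Rightarrow> ('k::comm_ring_1, 'n::finite) mfps set" where
  "order_ge N = {p. \<forall>e. mdeg e < N \<longrightarrow> mfps_coeff p e = 0}"

lemma order_ge_add: "p \<in> order_ge N \<Longrightarrow> q \<in> order_ge N \<Longrightarrow> p + q \<in> order_ge N"
  and order_ge_diff: "p \<in> order_ge N \<Longrightarrow> q \<in> order_ge N \<Longrightarrow> p - q \<in> order_ge N"
  by (auto simp: order_ge_def)

lemma order_ge_0: "order_ge 0 = UNIV"
  by (auto simp: order_ge_def)

lemma zero_in_order_ge: "0 \<in> order_ge N"
  by (auto simp: order_ge_def)

lemma order_ge_mult: "p \<in> order_ge M \<Longrightarrow> q \<in> order_ge N \<Longrightarrow> p * q \<in> order_ge (M + N)"
  unfolding order_ge_def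
proof safe
  fix e :: "nat ^ 'b"
  assume p: "\<forall>e. mdeg e < M \<longrightarrow> mfps_coeff p e = 0"
    and q: "\<forall>e. mdeg e < N \<longrightarrow> mfps_coeff q e = 0" and e: "mdeg e < M + N"
  have "mfps_coeff p a * mfps_coeff q b = 0" if "a + b = e" for a b
    using p q e that by (cases "mdeg a < M") auto
  then show "mfps_coeff (p * q) e = 0"
    unfolding coeff_mult by (intro sum.neutral) auto
qed

lemma order_ge_mult_left: "q \<in> order_ge N \<Longrightarrow> p * q \<in> order_ge N"
  using order_ge_mult[of p 0 q N] by (simp add: order_ge_0)

lemma order_ge_mono: "M \<le> N \<Longrightarrow> order_ge N \<subseteq> order_ge M"
  by (auto simp: order_ge_def)

lemma order_ge_Suc_0_iff: "p \<in> order_ge (Suc 0) \<longleftrightarrow> mfps_coeff p 0 = 0"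
  by (auto simp: order_ge_def)

lemma var_in_order_ge: "mfps_var i \<in> order_ge (Suc 0)"
  by (simp add: order_ge_Suc_0_iff)

lemma order_ge_sum: "(\<And>a. a \<in> A \<Longrightarrow> g a \<in> order_ge N) \<Longrightarrow> sum g A \<in> order_ge N"
  by (induction A rule: infinite_finite_induct) (auto intro: order_ge_add zero_in_order_ge)

text \<open>Every nonzero multi-index is charged to one of the variables occurring in it.\<close>

lemma order_ge_Suc_decompose:
  assumes "p \<in> order_ge (Suc N)"
  obtains q where "\<And>i. q i \<in> order_ge N" "p = (\<Sum>i\<in>UNIV. mfps_var i * q i)"
proof -
  define c where "c e = (SOME i. e $ i > 0)" for e :: "nat ^ 'b"
  have c: "e $ c e > 0" if "e $ i > 0" for e i
    unfolding c_def by (rule someI[of "\<lambda>i. e $ i > 0", OF that])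
  define q where
    "q i = Abs_mfps (\<lambda>e. if c (axis i 1 + e) = i then mfps_coeff p (axis i 1 + e) else 0)" for i
  have "q i \<in> order_ge N" for i
    using assms by (auto simp: order_ge_def q_def)
  moreover have "p = (\<Sum>i\<in>UNIV. mfps_var i * q i)"
  proof (rule mfps_eqI)
    fix e
    have monom: "mfps_coeff (mfps_var i * q i) e = (if c e = i then mfps_coeff p e else 0)"
      if "e \<noteq> 0" for i
    proof (cases "e $ i = 0")
      case True
      obtain j where "e $ j > 0" using \<open>e \<noteq> 0\<close> by (auto simp: vec_eq_iff)
      then have "c e \<noteq> i" using c True by fastforce
      then show ?thesis using True by (simp add: coeff_var_mult_0)
    next
      case False
      then obtain e' where "e = axis i 1 + e'" using mindex_split by blast
      then show ?thesis by (simp add: q_def)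
    qed
    show "mfps_coeff p e = mfps_coeff (\<Sum>i\<in>UNIV. mfps_var i * q i) e"
    proof (cases "e = 0")
      case True
      then show ?thesis using assms by (simp add: order_ge_def)
    qed (simp add: monom)
  qed
  ultimately show ?thesis using that by blast
qed

text \<open>In characteristic \<open>0\<close> the factor \<open>e' $ i + 1\<close> is invertible,
  so every coefficient except the constant one is determined by the gradient.\<close>

lemma order_ge_Suc_pderivI:
  fixes p :: "('k::field_char_0, 'n::finite) mfps"
  assumes "mfps_coeff p 0 = 0" and "\<And>i. mfps_pderiv i p \<in> order_ge N"
  shows "p \<in> order_ge (Suc N)"
  unfolding order_ge_def
proof safe
  fix e :: "nat ^ 'n" assume e: "mdeg e < Suc N"
  show "mfps_coeff p e = 0"
  proof (cases e rule: mindex_cases)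
    case (2 i e')
    then have "mdeg e' < N" using e by simp
    then have "mfps_coeff (mfps_pderiv i p) e' = 0" using assms(2) by (auto simp: order_ge_def)
    then have "(of_nat (e' $ i + 1) :: 'k) * mfps_coeff p e = 0"
      using 2 by (simp add: add.commute)
    moreover have "(of_nat (e' $ i + 1) :: 'k) \<noteq> 0" by (simp only: of_nat_eq_0_iff)
    ultimately show ?thesis by simp
  qed (use assms in simp)
qed

text \<open>The Euler operator multiplies a monomial by its total degree, so the terms of degree
  exactly \<open>N\<close> cancel.\<close>

lemma Euler_order:
  assumes "p \<in> order_ge N"
  shows "(\<Sum>i\<in>UNIV. mfps_var i * mfps_pderiv i p) - of_nat N * p \<in> order_ge (Suc N)"
proof -
  have of_nat: "(of_nat N :: ('a, 'b) mfps) = mfps_const (of_nat N)"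
    by (induction N) (simp_all add: const_simps)
  have "mfps_coeff (\<Sum>i\<in>UNIV. mfps_var i * mfps_pderiv i p) e = of_nat (mdeg e) * mfps_coeff p e" for e
    by (simp add: coeff_Euler mdeg_def sum_distrib_right)
  then show ?thesis
    using assms by (auto simp: order_ge_def of_nat less_Suc_eq)
qed

section \<open>Linear dependencies over subrings and bases of quotients\<close>

text \<open>Gaussian elimination without division.\<close>

lemma nontrivial_left_kernel:
  fixes S :: "'a::idom set" and a :: "'j \<Rightarrow> 'i \<Rightarrow> 'a"
  assumes S: "0 \<in> S" "1 \<in> S" "\<And>a b. a \<in> S \<Longrightarrow> b \<in> S \<Longrightarrow> a + b \<in> S"
      "\<And>a. a \<in> S \<Longrightarrow> - a \<in> S" "\<And>a b. a \<in> S \<Longrightarrow> b \<in> S \<Longrightarrow> a * b \<in> S"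
    and "finite I" "finite J" "card I < card J"
    and "\<And>i j. i \<in> I \<Longrightarrow> j \<in> J \<Longrightarrow> a j i \<in> S"
  shows "\<exists>c. (\<forall>j\<in>J. c j \<in> S) \<and> (\<exists>j\<in>J. c j \<noteq> 0) \<and> (\<forall>i\<in>I. (\<Sum>j\<in>J. c j * a j i) = 0)"
  using assms(6-9)
proof (induction I arbitrary: J a rule: finite_induct)
  case empty
  then obtain j where "j \<in> J" by fastforce
  then show ?case using S by (intro exI[of _ "\<lambda>_. 1"]) auto
next
  case (insert i I)
  show ?case
  proof (cases "\<forall>j\<in>J. a j i = 0")
    case True
    have "card I < card J" using insert.prems insert.hyps by simp
    from insert.IH[OF insert.prems(1) this, of a] insert.prems(3) True show ?thesis by auto
  next
    case False
    then obtain p where p: "p \<in> J" "a p i \<noteq> 0" by blast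
    define b where "b j l = a p i * a j l + - (a j i * a p l)" for j l
    have "card I < card (J - {p})" using insert.prems insert.hyps p by simp
    moreover have "b j l \<in> S" if "l \<in> I" "j \<in> J - {p}" for j l
      unfolding b_def using that insert.prems(3) p(1) by (intro S) auto
    ultimately obtain c where c: "\<forall>j\<in>J - {p}. c j \<in> S" "\<exists>j\<in>J - {p}. c j \<noteq> 0"
        "\<forall>l\<in>I. (\<Sum>j\<in>J - {p}. c j * b j l) = 0"
      using insert.IH[of "J - {p}" b] insert.prems(1) by blast
    \<comment> \<open>Expanding the relation \<open>c\<close> among the eliminated rows
      \<open>b j\<close> in the original rows gives these coefficients; \<open>p\<close> is the
      pivot row.\<close>
    define d where "d j = (if j = p then - (\<Sum>j\<in>J - {p}. c j * a j i) else a p i * c j)" for j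
    have sum_S: "sum g A \<in> S" if "\<And>x. x \<in> A \<Longrightarrow> g x \<in> S" for g :: "'j \<Rightarrow> 'a" and A
      using that by (induction A rule: infinite_finite_induct) (auto intro: S)
    have "\<forall>j\<in>J. d j \<in> S"
      using c(1) p(1) insert.prems(3) by (auto simp: d_def intro!: S sum_S)
    moreover have "\<exists>j\<in>J. d j \<noteq> 0"
      using c(2) p by (auto simp: d_def)
    moreover have "(\<Sum>j\<in>J. d j * a j l) = 0" if "l \<in> insert i I" for l
    proof -
      have "(\<Sum>j\<in>J. d j * a j l) = d p * a p l + (\<Sum>j\<in>J - {p}. d j * a j l)"
        using p insert.prems(1) by (simp add: sum.remove)
      also have "(\<Sum>j\<in>J - {p}. d j * a j l) = (\<Sum>j\<in>J - {p}. a p i * c j * a j l)"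
        by (intro sum.cong) (auto simp: d_def)
      also have "d p * a p l + \<dots> = (\<Sum>j\<in>J - {p}. c j * b j l)"
        by (simp add: d_def b_def sum_distrib_right sum_distrib_left sum_subtractf[symmetric]
            sum_negf[symmetric] sum.distrib[symmetric] algebra_simps)
      also have "\<dots> = 0"
        using that c(3) by (auto simp: b_def)
      finally show ?thesis .
    qed
    ultimately show ?thesis by blast
  qed
qed

section \<open>Bases of quotient spaces and bounds on their size\<close>

context vector_space
begin

lemma quotient_basis_exists:
  assumes "subspace V" "subspace W" "W \<subseteq> V"
  shows "\<exists>B. quotient_basis scale V W B"
proof -
  obtain B0 where B0: "B0 \<subseteq> W" "independent B0" "W \<subseteq> span B0"
    using maximal_independent_subset by blast
  obtain B where B: "B0 \<subseteq> B" "B \<subseteq> V" "independent B" "V \<subseteq> span B"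
    using maximal_independent_subset_extend[of B0 V] B0 assms by blast
  have span: "span (W \<union> A) = span (B0 \<union> A)" for A
  proof (rule antisym)
    show "span (W \<union> A) \<subseteq> span (B0 \<union> A)"
    proof (rule span_minimal)
      show "W \<union> A \<subseteq> span (B0 \<union> A)"
        using B0(3) span_mono[of B0 "B0 \<union> A"] span_superset[of "B0 \<union> A"] by blast
    qed (rule subspace_span)
    show "span (B0 \<union> A) \<subseteq> span (W \<union> A)" by (intro span_mono) (use B0 in auto)
  qed
  have "b \<notin> span (W \<union> (B - B0 - {b}))" if "b \<in> B - B0" for b
  proof -
    have "B0 \<union> (B - B0 - {b}) = B - {b}" using that B(1) by auto
    then show ?thesis using B(3) that unfolding span dependent_def by auto
  qed
  moreover have "V \<subseteq> span (W \<union> (B - B0))"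
    using B(1,4) unfolding span by (simp add: Un_absorb1)
  ultimately have "quotient_basis scale V W (B - B0)"
    using B(2) unfolding quotient_basis_def by auto
  then show ?thesis ..
qed

lemma span_finite_subspace_Un:
  assumes "subspace W" "finite B"
  shows "v \<in> span (W \<union> B) \<longleftrightarrow> (\<exists>c. v - (\<Sum>b\<in>B. scale (c b) b) \<in> W)"
proof -
  have "v \<in> span (W \<union> B) \<longleftrightarrow> (\<exists>w\<in>W. \<exists>u\<in>span B. v = w + u)"
    unfolding span_Un span_eq_iff[THEN iffD2, OF assms(1)] by blast
  also have "\<dots> \<longleftrightarrow> (\<exists>u\<in>span B. v - u \<in> W)"
    by (metis add_diff_cancel_right' diff_add_cancel)
  also have "\<dots> \<longleftrightarrow> (\<exists>c. v - (\<Sum>b\<in>B. scale (c b) b) \<in> W)"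
    unfolding span_finite[OF assms(2)] by blast
  finally show ?thesis .
qed

text \<open>Dividing by a nonzero coefficient would put \<open>b\<close> into the span of
  \<open>W\<close> and the other basis elements.\<close>

lemma quotient_basis_independent:
  assumes "quotient_basis scale V W B" "subspace W" "finite A" "A \<subseteq> B"
    and "(\<Sum>b\<in>A. scale (c b) b) \<in> W" and "b \<in> A"
  shows "c b = 0"
proof (rule ccontr)
  assume "c b \<noteq> 0"
  let ?s = "\<Sum>b\<in>A - {b}. scale (c b) b"
  have "(\<Sum>b\<in>A. scale (c b) b) = scale (c b) b + ?s"
    using assms by (simp add: sum.remove)
  then have eq: "scale (c b) b = (\<Sum>b\<in>A. scale (c b) b) - ?s" by simp
  have "?s \<in> span (W \<union> (B - {b}))"
    using assms(4) by (intro span_sum span_scale span_base) auto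
  moreover have "(\<Sum>b\<in>A. scale (c b) b) \<in> span (W \<union> (B - {b}))"
    using assms(5) by (intro span_base) auto
  ultimately have "scale (c b) b \<in> span (W \<union> (B - {b}))"
    unfolding eq by (intro span_diff)
  from span_scale[OF this, of "inverse (c b)"] have "b \<in> span (W \<union> (B - {b}))"
    using \<open>c b \<noteq> 0\<close> by simp
  then show False using assms unfolding quotient_basis_def by blast
qed

text \<open>The values \<open>f b i\<close> serve as coordinates: more than \<open>card I\<close>
  elements satisfy a nontrivial relation in all of them, which \<open>dep\<close> turns into a
  relation modulo \<open>W\<close>.\<close>

lemma quotient_basis_card_le:
  assumes B: "quotient_basis scale V W B" and W: "subspace W"
    and "finite I"
    and dep: "\<And>A c. finite A \<Longrightarrow> A \<subseteq> V \<Longrightarrow> (\<forall>i\<in>I. (\<Sum>b\<in>A. c b * f b i) = 0) \<Longrightarrow>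
      (\<Sum>b\<in>A. scale (c b) b) \<in> W"
  shows "finite B \<and> card B \<le> card I"
proof -
  have "card A \<le> card I" if A: "finite A" "A \<subseteq> B" for A
  proof (rule ccontr)
    assume "\<not> card A \<le> card I"
    then obtain c where c: "\<exists>b\<in>A. c b \<noteq> 0" "\<forall>i\<in>I. (\<Sum>b\<in>A. c b * f b i) = 0"
      using nontrivial_left_kernel[of UNIV I A f] A \<open>finite I\<close> by auto
    have "A \<subseteq> V" using A(2) B unfolding quotient_basis_def by blast
    from dep[OF A(1) this c(2)] c(1) quotient_basis_independent[OF B W A] show False by blast
  qed
  \<comment> \<open>A uniform bound on the finite subsets of \<open>B\<close> also shows that
    \<open>B\<close> is finite.\<close>
  then show ?thesis
    using finite_if_finite_subsets_card_bdd[of B "card I"] by blast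
qed

lemma quotient_basis_finite:
  assumes B: "quotient_basis scale V W B" and W: "subspace W"
    and F: "finite F" "V \<subseteq> span (W \<union> F)"
  shows "finite B"
proof -
  have "\<exists>c. v - (\<Sum>b\<in>F. scale (c b) b) \<in> W" if "v \<in> V" for v
    using that F span_finite_subspace_Un[OF W F(1)] by blast
  then obtain f where f: "\<And>v. v \<in> V \<Longrightarrow> v - (\<Sum>b\<in>F. scale (f v b) b) \<in> W" by metis
  have "(\<Sum>b\<in>A. scale (c b) b) \<in> W"
    if A: "finite A" "A \<subseteq> V" "\<forall>i\<in>F. (\<Sum>b\<in>A. c b * f b i) = 0" for A c
  proof -
    have "(\<Sum>b\<in>A. scale (c b) b) = (\<Sum>b\<in>A. scale (c b) b) - (\<Sum>i\<in>F. scale (\<Sum>b\<in>A. c b * f b i) i)"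
      using A(3) by simp
    also have "(\<Sum>i\<in>F. scale (\<Sum>b\<in>A. c b * f b i) i) =
        (\<Sum>b\<in>A. scale (c b) (\<Sum>i\<in>F. scale (f b i) i))"
      by (simp add: scale_sum_left scale_sum_right sum.swap[of _ A])
    also have "(\<Sum>b\<in>A. scale (c b) b) - \<dots> =
        (\<Sum>b\<in>A. scale (c b) (b - (\<Sum>i\<in>F. scale (f b i) i)))"
      by (simp add: scale_right_diff_distrib sum_subtractf)
    also have "\<dots> \<in> W"
      using A(2) f by (intro subspace_sum[OF W] subspace_scale[OF W]) auto
    finally show ?thesis .
  qed
  from quotient_basis_card_le[OF B W F(1) this] show ?thesis by blast
qed

end

section \<open>Ideals\<close>

interpretation ring_module: module "(*) :: 'a::comm_ring_1 \<Rightarrow> 'a \<Rightarrow> 'a"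
  by (rule module_ring)

declare ring_module.scale_scale [simp del]

lemma ideal_gen_singleton: "ideal_gen {x} = {r. x dvd r}"
  by (auto simp: ring_module.span_singleton dvd_def mult.commute)

lemma ideal_multI: "a \<in> I \<Longrightarrow> b \<in> J \<Longrightarrow> a * b \<in> ideal_mult I J"
  unfolding ideal_mult_def by (intro ring_module.span_base) auto

lemma ideal_mult_subset:
  assumes "is_ideal K" "\<And>a b. a \<in> I \<Longrightarrow> b \<in> J \<Longrightarrow> a * b \<in> K"
  shows "ideal_mult I J \<subseteq> K"
  unfolding ideal_mult_def by (intro ring_module.span_minimal assms) (use assms in auto)

lemma is_ideal_mult: "is_ideal (ideal_mult I J)"
  unfolding ideal_mult_def by (rule ring_module.subspace_span)

lemma is_ideal_order_ge: "is_ideal (order_ge N)"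
  by (auto simp: ring_module.subspace_def order_ge_add zero_in_order_ge order_ge_mult_left)

text \<open>Through this inclusion the condition of \<open>presentation\<close> on the kernel
  becomes the vanishing of constant and linear coefficients.\<close>

lemma ideal_power_vars_subset:
  "ideal_power (ideal_gen (range mfps_var)) N \<subseteq> (order_ge N :: ('k::comm_ring_1, 'n::finite) mfps set)"
proof (induction N)
  case (Suc N)
  have 1: "ideal_gen (range mfps_var) \<subseteq> (order_ge (Suc 0) :: ('k, 'n) mfps set)"
    by (rule ring_module.span_minimal) (auto simp: var_in_order_ge is_ideal_order_ge)
  have "p * q \<in> order_ge (Suc N)"
    if "p \<in> ideal_gen (range mfps_var)" "q \<in> ideal_power (ideal_gen (range mfps_var)) N"
    for p q :: "('k, 'n) mfps"
    using order_ge_mult[OF subsetD[OF 1 that(1)] subsetD[OF Suc that(2)]] by simp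
  then show ?case by (simp add: ideal_mult_subset is_ideal_order_ge)
qed (simp add: order_ge_0)

section \<open>Presented complete local rings\<close>

locale presented_curve =
  fixes \<iota> :: "'k::field_char_0 \<Rightarrow> 'r::idom" and m :: "'r set" and x :: 'r
    and \<phi> :: "('k, 'n::finite) mfps \<Rightarrow> 'r" and f :: "('k, 'n) mfps ^ 'm::finite"
  assumes hom_iota: "ring_homomorphism \<iota>"
    and local: "local_ring m"
    and complete: "adically_complete m"
    and reduction: "minimal_reduction x m"
    and pres: "presentation \<iota> \<phi> f"
begin

lemma iota_simps [simp]:
  "\<iota> 1 = 1" "\<iota> (a + b) = \<iota> a + \<iota> b" "\<iota> (a * b) = \<iota> a * \<iota> b" "\<iota> 0 = 0" "\<iota> (- a) = - \<iota> a"
  "\<iota> (a - b) = \<iota> a - \<iota> b"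
proof -
  show add: "\<iota> 1 = 1" "\<iota> (a + b) = \<iota> a + \<iota> b" "\<iota> (a * b) = \<iota> a * \<iota> b" for a b
    using hom_iota by (auto simp: ring_homomorphism_def)
  show zero: "\<iota> 0 = 0" using add(2)[of 0 0] by (metis add_0 add_cancel_right_right)
  show uminus: "\<iota> (- a) = - \<iota> a" for a
    using add(2)[of a "- a"] zero by (simp add: eq_neg_iff_add_eq_0 add.commute)
  show "\<iota> (a - b) = \<iota> a - \<iota> b" using add(2)[of a "- b"] uminus by simp
qed

lemma iota_eq_0_iff [simp]: "\<iota> c = 0 \<longleftrightarrow> c = 0"
proof
  assume "\<iota> c = 0"
  then have "\<iota> (inverse c * c) = 0" by (simp only: iota_simps mult_zero_right)
  then show "c = 0" by (cases "c = 0") auto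
qed simp

lemma iota_sum: "\<iota> (sum g A) = (\<Sum>a\<in>A. \<iota> (g a))"
  by (induction A rule: infinite_finite_induct) auto

lemma iota_of_nat: "\<iota> (of_nat N) = of_nat N"
  by (induction N) auto

lemma phi_simps [simp]:
  "\<phi> 1 = 1" "\<phi> (p + q) = \<phi> p + \<phi> q" "\<phi> (p * q) = \<phi> p * \<phi> q" "\<phi> 0 = 0" "\<phi> (- p) = - \<phi> p"
  "\<phi> (p - q) = \<phi> p - \<phi> q" "\<phi> (mfps_const c) = \<iota> c"
proof -
  show add: "\<phi> 1 = 1" "\<phi> (p + q) = \<phi> p + \<phi> q" "\<phi> (p * q) = \<phi> p * \<phi> q" for p q
    using pres by (auto simp: presentation_def ring_homomorphism_def)
  show zero: "\<phi> 0 = 0" using add(2)[of 0 0] by (metis add_0 add_cancel_right_right)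
  show uminus: "\<phi> (- p) = - \<phi> p" for p
    using add(2)[of p "- p"] zero by (simp add: eq_neg_iff_add_eq_0 add.commute)
  show "\<phi> (p - q) = \<phi> p - \<phi> q" using add(2)[of p "- q"] uminus by simp
  show "\<phi> (mfps_const c) = \<iota> c" using pres by (auto simp: presentation_def)
qed

lemma phi_sum: "\<phi> (sum g A) = (\<Sum>a\<in>A. \<phi> (g a))"
  by (induction A rule: infinite_finite_induct) auto

lemma phi_surj: obtains p where "\<phi> p = r"
  using pres unfolding presentation_def surj_def by metis

lemma ker_phi: "\<phi> p = 0 \<longleftrightarrow> p \<in> ideal_gen (range (($) f))"
  using pres unfolding presentation_def by blast

text \<open>Consequently two lifts of one element agree in their constant and linear coefficients,
  so equations in \<open>R\<close> can be compared in these degrees.\<close>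

lemma ker_phi_order: "\<phi> p = 0 \<Longrightarrow> p \<in> order_ge 2"
  using pres ideal_power_vars_subset unfolding presentation_def by blast

lemma is_ideal_phi_image:
  assumes "is_ideal I"
  shows "is_ideal (\<phi> ` I)"
proof -
  have "r * s \<in> \<phi> ` I" if s: "s \<in> \<phi> ` I" for r s
  proof -
    obtain p where "\<phi> p = r" by (rule phi_surj)
    moreover obtain q where "q \<in> I" "s = \<phi> q" using s by blast
    ultimately have "r * s = \<phi> (p * q)" "p * q \<in> I"
      using assms by (auto simp: ring_module.subspace_def)
    then show ?thesis by blast
  qed
  moreover have "0 \<in> \<phi> ` I"
    using assms phi_simps(4) unfolding ring_module.subspace_def by (metis imageI)
  moreover have "r + s \<in> \<phi> ` I" if rs: "r \<in> \<phi> ` I" "s \<in> \<phi> ` I" for r s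
  proof -
    obtain p q where "p \<in> I" "r = \<phi> p" "q \<in> I" "s = \<phi> q" using rs by blast
    then have "p + q \<in> I" "r + s = \<phi> (p + q)" using assms by (auto simp: ring_module.subspace_def)
    then show ?thesis by blast
  qed
  ultimately show ?thesis by (simp add: ring_module.subspace_def)
qed

text \<open>A larger ideal contains the image of a series with nonzero constant term, hence a unit
  from \<open>k\<close>; so the image is maximal and \<open>local\<close> identifies it with
  \<open>m\<close>.\<close>

lemma m_eq: "m = \<phi> ` order_ge (Suc 0)"
proof -
  let ?M = "\<phi> ` order_ge (Suc 0)"
  have "1 \<notin> ?M"
  proof
    assume "1 \<in> ?M"
    then obtain q where q: "q \<in> order_ge (Suc 0)" "\<phi> q = 1" by force
    then have "1 - q \<in> order_ge 2" by (intro ker_phi_order) simp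
    then have "mfps_coeff (1 - q) 0 = 0"
      by (simp only: order_ge_def mem_Collect_eq) (metis mdeg_0 zero_less_numeral)
    then show False using q by (simp add: order_ge_Suc_0_iff)
  qed
  moreover have "J = UNIV" if J: "is_ideal J" "?M \<subset> J" for J
  proof -
    obtain p where p: "\<phi> p \<in> J" "\<phi> p \<notin> ?M" using J(2) by (metis psubset_imp_ex_mem Diff_iff phi_surj)
    let ?c = "mfps_coeff p 0"
    have "p - mfps_const ?c \<in> order_ge (Suc 0)" by (simp add: order_ge_Suc_0_iff)
    then have *: "\<phi> (p - mfps_const ?c) \<in> J" using J(2) by blast
    have "?c \<noteq> 0" using p by (auto simp: order_ge_Suc_0_iff)
    have "\<iota> ?c = \<phi> p - \<phi> (p - mfps_const ?c)" by simp
    then have "\<iota> ?c \<in> J" using ring_module.subspace_diff[OF J(1) p(1) *] by simp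
    then have "\<iota> (inverse ?c) * \<iota> ?c \<in> J" using J(1) by (simp add: ring_module.subspace_def)
    then have "1 \<in> J" using \<open>?c \<noteq> 0\<close> by (metis iota_simps(1,3) left_inverse)
    then show ?thesis using J(1) unfolding ring_module.subspace_def by (metis UNIV_eq_I mult.right_neutral)
  qed
  moreover have "is_ideal ?M" by (intro is_ideal_phi_image is_ideal_order_ge)
  ultimately have "maximal_ideal ?M" unfolding maximal_ideal_def by blast
  then have "?M = m" using local by (simp add: local_ring_def)
  then show ?thesis by (rule sym)
qed

text \<open>Splitting off a variable lowers the order by one, so powers of \<open>m\<close> can be
  handled through the orders of lifts.\<close>

lemma m_power_eq: "ideal_power m N = \<phi> ` order_ge N"
proof (induction N)
  case 0
  then show ?case using phi_surj by (auto simp: order_ge_0 image_iff) metis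
next
  case (Suc N)
  have "ideal_mult m (\<phi> ` order_ge N) \<subseteq> \<phi> ` order_ge (Suc N)"
  proof (rule ideal_mult_subset)
    fix a b assume "a \<in> m" "b \<in> \<phi> ` order_ge N"
    then obtain p q where "p \<in> order_ge (Suc 0)" "q \<in> order_ge N" "a = \<phi> p" "b = \<phi> q"
      unfolding m_eq by blast
    then have "p * q \<in> order_ge (Suc N)" "a * b = \<phi> (p * q)" using order_ge_mult[of p "Suc 0" q N] by auto
    then show "a * b \<in> \<phi> ` order_ge (Suc N)" by blast
  qed (intro is_ideal_phi_image is_ideal_order_ge)
  moreover have "\<phi> p \<in> ideal_mult m (\<phi> ` order_ge N)" if "p \<in> order_ge (Suc N)" for p
  proof -
    obtain q where q: "\<And>i. q i \<in> order_ge N" "p = (\<Sum>i\<in>UNIV. mfps_var i * q i)"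
      using order_ge_Suc_decompose[OF \<open>p \<in> order_ge (Suc N)\<close>] by blast
    then have "\<phi> p = (\<Sum>i\<in>UNIV. \<phi> (mfps_var i) * \<phi> (q i))" by (simp add: phi_sum)
    also have "\<dots> \<in> ideal_mult m (\<phi> ` order_ge N)"
      using q var_in_order_ge unfolding m_eq
      by (intro ring_module.subspace_sum is_ideal_mult ideal_multI) auto
    finally show ?thesis .
  qed
  ultimately show ?case using Suc by auto
qed

lemma x_power_in: "x ^ N dvd r \<Longrightarrow> r \<in> ideal_power m N"
proof (induction N arbitrary: r)
  case (Suc N)
  obtain s where "r = x ^ Suc N * s" using Suc.prems by (rule dvdE)
  then have r: "r = x * (x ^ N * s)" by (simp only: power_Suc mult.assoc)
  have "x ^ N * s \<in> ideal_power m N" by (rule Suc.IH) simp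
  moreover have "x \<in> m" using reduction by (simp add: minimal_reduction_def)
  ultimately show ?case unfolding r by (simp add: ideal_multI)
qed simp

lemma x_divisible_eq_0:
  assumes "\<And>N. x ^ N dvd r"
  shows "r = 0"
proof -
  have "r \<in> (\<Inter>i. ideal_power m i)" using assms x_power_in by blast
  then show ?thesis using complete unfolding adically_complete_def by auto
qed

text \<open>The equation \<open>x m^k = m^(k+1)\<close> persists for larger exponents, so the
  \<open>x\<close>-adic and \<open>m\<close>-adic topologies agree up to the shift
  \<open>k\<close>.\<close>

lemma x_divides_m_power: "\<exists>k. \<forall>N. \<forall>r\<in>ideal_power m (N + k). x ^ N dvd r"
proof -
  obtain k where k: "(*) x ` ideal_power m k = ideal_power m (Suc k)"
    using reduction by (auto simp: minimal_reduction_def)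
  have step: "ideal_power m (Suc j) = (*) x ` ideal_power m j" if "j \<ge> k" for j
    using that
  proof (induction j rule: nat_induct_at_least)
    case (Suc j)
    have "ideal_power m (Suc (Suc j)) \<subseteq> (*) x ` ideal_power m (Suc j)"
    proof
      fix r assume "r \<in> ideal_power m (Suc (Suc j))"
      then obtain p where p: "p \<in> order_ge (Suc (Suc j))" "r = \<phi> p" unfolding m_power_eq by blast
      obtain q where q: "\<And>i. q i \<in> order_ge (Suc j)" "p = (\<Sum>i\<in>UNIV. mfps_var i * q i)"
        using order_ge_Suc_decompose[OF p(1)] by blast
      have "\<exists>s\<in>order_ge j. \<phi> (q i) = x * \<phi> s" for i
        using q(1)[of i] Suc.IH unfolding m_power_eq by blast
      then obtain s where s: "\<And>i. s i \<in> order_ge j" "\<And>i. \<phi> (q i) = x * \<phi> (s i)" by metis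
      have "r = x * \<phi> (\<Sum>i\<in>UNIV. mfps_var i * s i)"
        using p q s by (simp add: phi_sum sum_distrib_left algebra_simps)
      moreover have "mfps_var i * s i \<in> order_ge (Suc j)" for i
        using order_ge_mult[OF var_in_order_ge s(1)] by simp
      then have "(\<Sum>i\<in>UNIV. mfps_var i * s i) \<in> order_ge (Suc j)"
        by (intro order_ge_sum)
      ultimately show "r \<in> (*) x ` ideal_power m (Suc j)" unfolding m_power_eq by blast
    qed
    moreover have "(*) x ` ideal_power m (Suc j) \<subseteq> ideal_power m (Suc (Suc j))"
      using reduction by (auto simp: minimal_reduction_def intro: ideal_multI)
    ultimately show ?case by blast
  qed (use k in blast)
  have "\<forall>r\<in>ideal_power m (N + k). x ^ N dvd r" for N
  proof (induction N)
    case (Suc N)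
    then show ?case using step[of "N + k"] by (auto intro: mult_dvd_mono)
  qed simp
  then show ?thesis by blast
qed

section \<open>The minimal reduction, its linear form, and the quotient modulo
  \<open>x\<close>\<close>

definition X :: "('k, 'n) mfps" where
  "X = (SOME p. p \<in> order_ge (Suc 0) \<and> \<phi> p = x)"

lemma X: "mfps_coeff X 0 = 0" "\<phi> X = x"
proof -
  have "x \<in> \<phi> ` order_ge (Suc 0)"
    using reduction m_eq by (simp add: minimal_reduction_def)
  then have "\<exists>p. p \<in> order_ge (Suc 0) \<and> \<phi> p = x" by blast
  from someI_ex[OF this] show "mfps_coeff X 0 = 0" "\<phi> X = x"
    by (simp_all add: X_def order_ge_Suc_0_iff)
qed

text \<open>The class of \<open>x\<close> modulo the square of \<open>m\<close>, in the coordinates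
  given by the variables.\<close>

definition lin :: "'n \<Rightarrow> 'k" where
  "lin i = mfps_coeff X (axis i 1)"

text \<open>A minimal reduction is not in the square of the maximal ideal, as otherwise the descending
  chain of the powers of the latter would become constant and hence \<open>0\<close>.\<close>

lemma lin_nonzero: "\<exists>i. lin i \<noteq> 0"
proof (rule ccontr)
  assume "\<nexists>i. lin i \<noteq> 0"
  then have X2: "X \<in> order_ge (Suc (Suc 0))"
    using X(1) by (intro order_ge_Suc_pderivI[of X "Suc 0"]) (auto simp: order_ge_Suc_0_iff lin_def)
  obtain k where k: "(*) x ` ideal_power m k = ideal_power m (Suc k)"
    using reduction by (auto simp: minimal_reduction_def)
  \<comment> \<open>An element of \<open>m^(k+1)\<close> is \<open>x\<close> times one of
    \<open>m^k\<close>, so it has a lift of order \<open>k + 2\<close>; applying the induction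
    hypothesis to the cofactors of the variables gains one more order.\<close>
  have "ideal_power m (Suc k) \<subseteq> ideal_power m (Suc (k + j))" for j
  proof (induction j)
    case (Suc j)
    have "\<phi> p \<in> \<phi> ` order_ge (Suc (Suc (k + j)))" if p: "p \<in> order_ge (Suc k)" for p
    proof -
      have "\<phi> p \<in> (*) x ` \<phi> ` order_ge k" using k p unfolding m_power_eq by simp
      then obtain q where q: "q \<in> order_ge k" "\<phi> p = \<phi> (X * q)"
        using X(2) by auto
      have "X * q \<in> order_ge (Suc (Suc k))" using order_ge_mult[OF X2 q(1)] by simp
      then obtain s where s: "\<And>i. s i \<in> order_ge (Suc k)" "X * q = (\<Sum>i\<in>UNIV. mfps_var i * s i)"
        using order_ge_Suc_decompose by blast
      have "\<exists>u\<in>order_ge (Suc (k + j)). \<phi> (s i) = \<phi> u" for i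
        using s(1)[of i] Suc unfolding m_power_eq by blast
      then obtain u where u: "\<And>i. u i \<in> order_ge (Suc (k + j))" "\<And>i. \<phi> (s i) = \<phi> (u i)" by metis
      have "\<phi> p = \<phi> (\<Sum>i\<in>UNIV. mfps_var i * u i)" using q(2) s(2) u(2) by (simp add: phi_sum)
      moreover have "mfps_var i * u i \<in> order_ge (Suc (Suc (k + j)))" for i
        using order_ge_mult[OF var_in_order_ge u(1)] by simp
      then have "(\<Sum>i\<in>UNIV. mfps_var i * u i) \<in> order_ge (Suc (Suc (k + j)))"
        by (intro order_ge_sum)
      ultimately show ?thesis by blast
    qed
    then show ?case unfolding m_power_eq by auto
  qed simp
  then have sub: "ideal_power m (Suc k) \<subseteq> ideal_power m i" for i
    using order_ge_mono[of i "Suc (k + i)"] unfolding m_power_eq by fastforce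
  \<comment> \<open>A power of a variable now lies in every power of \<open>m\<close>, hence is
    zero; in a domain the variable itself becomes zero, although it has order one.\<close>
  fix i :: 'n
  have "mfps_var i ^ N \<in> order_ge N" for N
  proof (induction N)
    case (Suc N)
    then show ?case using order_ge_mult[OF var_in_order_ge Suc] by simp
  qed (simp add: order_ge_0)
  then have "\<phi> (mfps_var i ^ Suc k) \<in> ideal_power m (Suc k)" unfolding m_power_eq by blast
  then have "\<phi> (mfps_var i ^ Suc k) \<in> (\<Inter>i. ideal_power m i)" using sub by blast
  then have "\<phi> (mfps_var i ^ Suc k) = 0" using complete unfolding adically_complete_def by auto
  moreover have "\<phi> (p ^ N) = \<phi> p ^ N" for p N by (induction N) auto
  ultimately have "\<phi> (mfps_var i) = 0" by (metis power_eq_0_iff)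
  then have "(mfps_var i :: ('k, 'n) mfps) \<in> order_ge 2" by (rule ker_phi_order)
  moreover have "mdeg (axis i 1 :: nat ^ 'n) < 2" by simp
  ultimately have "mfps_coeff (mfps_var i :: ('k, 'n) mfps) (axis i 1) = 0"
    unfolding order_ge_def by blast
  then show False by simp
qed

lemma x_nonzero: "x \<noteq> 0"
proof
  assume "x = 0"
  then have "X \<in> order_ge 2" using ker_phi_order X by simp
  then have "lin i = 0" for i by (auto simp: order_ge_def lin_def)
  then show False using lin_nonzero by blast
qed

sublocale vs: vector_space "alg_scale \<iota>"
  by standard (simp_all add: alg_scale_def algebra_simps)

lemma ideal_subspace: "is_ideal I \<Longrightarrow> vs.subspace I"
  by (auto simp: ring_module.subspace_def vs.subspace_def alg_scale_def)

text \<open>Some power \<open>m^(k+1)\<close> lies in \<open>(x)\<close>, so the monomials of degree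
  at most \<open>k\<close> span the quotient.\<close>

lemma finite_span_mod_x: "\<exists>F. finite F \<and> UNIV \<subseteq> vs.span ({r. x dvd r} \<union> F)"
proof -
  obtain k where k: "\<forall>N. \<forall>r\<in>ideal_power m (N + k). x ^ N dvd r" using x_divides_m_power by blast
  define monom :: "nat ^ 'n \<Rightarrow> ('k, 'n) mfps" where "monom a = Abs_mfps (\<lambda>e. if e = a then 1 else 0)" for a
  let ?E = "{e :: nat ^ 'n. mdeg e < Suc k}"
  let ?F = "(\<lambda>e. \<phi> (monom e)) ` ?E"
  have "finite ?E"
  proof (rule finite_subset)
    have "e $ i \<le> mdeg e" for e :: "nat ^ 'n" and i
      unfolding mdeg_def by (rule member_le_sum) auto
    then have "e $ i \<le> k" if "mdeg e < Suc k" for e :: "nat ^ 'n" and i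
      using that by (meson le_trans less_Suc_eq_le)
    then show "?E \<subseteq> vec_lambda ` (\<Pi>\<^sub>E i\<in>UNIV. {..k})"
      by (auto intro!: image_eqI[of _ _ "($) _"])
    show "finite (vec_lambda ` (\<Pi>\<^sub>E i\<in>(UNIV :: 'n set). {..k}))"
      by (intro finite_imageI finite_PiE) auto
  qed
  have "r \<in> vs.span ({r. x dvd r} \<union> ?F)" for r
  proof -
    obtain p where p: "\<phi> p = r" by (rule phi_surj)
    let ?t = "\<Sum>e\<in>?E. mfps_const (mfps_coeff p e) * monom e"
    have "p - ?t \<in> order_ge (Suc k)"
      using \<open>finite ?E\<close> by (auto simp: order_ge_def monom_def sum.delta' if_distrib cong: if_cong)
    then have "\<phi> (p - ?t) \<in> ideal_power m (1 + k)"
      unfolding m_power_eq plus_1_eq_Suc by (rule imageI)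
    then have "x dvd \<phi> (p - ?t)" using k by (metis power_one_right)
    moreover have "\<phi> ?t = (\<Sum>e\<in>?E. alg_scale \<iota> (mfps_coeff p e) (\<phi> (monom e)))"
      by (simp add: phi_sum alg_scale_def)
    moreover have "\<dots> \<in> vs.span ({r. x dvd r} \<union> ?F)"
      by (intro vs.span_sum vs.span_scale vs.span_base) blast
    ultimately have "\<phi> (p - ?t) + \<phi> ?t \<in> vs.span ({r. x dvd r} \<union> ?F)"
      by (intro vs.span_add[OF vs.span_base]) auto
    then show ?thesis using p by simp
  qed
  then show ?thesis using \<open>finite ?E\<close> by blast
qed

end

section \<open>Power series in the minimal reduction\<close>

context presented_curve
begin

text \<open>\<open>Kx\<close> is \<open>k[x]\<close>, and \<open>PS\<close> below, its closure in the \<open>x\<close>-adic topology, is \<open>k[[x]]\<close>.\<close>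

inductive_set Kx :: "'r set" where
  const: "\<iota> c \<in> Kx"
| step: "p \<in> Kx \<Longrightarrow> \<iota> c + x * p \<in> Kx"

lemma Kx_decompose: "p \<in> Kx \<Longrightarrow> \<exists>c. \<exists>p'\<in>Kx. p = \<iota> c + x * p'"
proof (induction rule: Kx.induct)
  case (const c)
  have "\<iota> c = \<iota> c + x * \<iota> 0" by simp
  then show ?case using Kx.const by blast
qed blast

lemma Kx_add: "p \<in> Kx \<Longrightarrow> q \<in> Kx \<Longrightarrow> p + q \<in> Kx"
proof (induction arbitrary: q rule: Kx.induct)
  case (const c)
  obtain d q' where "q' \<in> Kx" "q = \<iota> d + x * q'" using Kx_decompose[OF const] by blast
  then show ?case using Kx.step[of q' "c + d"] by (simp add: algebra_simps)
next
  case (step p c)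
  obtain d q' where "q' \<in> Kx" "q = \<iota> d + x * q'" using Kx_decompose[OF step.prems] by blast
  then show ?case using Kx.step[of "p + q'" "c + d"] step.IH by (simp add: algebra_simps)
qed

lemma Kx_x_mult: "p \<in> Kx \<Longrightarrow> x * p \<in> Kx"
  using Kx.step[of p 0] by simp

lemma Kx_const_mult: "p \<in> Kx \<Longrightarrow> \<iota> d * p \<in> Kx"
proof (induction rule: Kx.induct)
  case (const c)
  then show ?case using Kx.const[of "d * c"] by simp
next
  case (step p c)
  then show ?case using Kx.step[of "\<iota> d * p" "d * c"] by (simp add: algebra_simps)
qed

lemma Kx_mult: "p \<in> Kx \<Longrightarrow> q \<in> Kx \<Longrightarrow> p * q \<in> Kx"
proof (induction rule: Kx.induct)
  case (step p c)
  have "\<iota> c * q + x * (p * q) \<in> Kx" using step by (intro Kx_add Kx_const_mult Kx_x_mult) auto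
  then show ?case by (simp add: algebra_simps)
qed (rule Kx_const_mult)

definition PS :: "'r set" where
  "PS = {l. \<forall>N. \<exists>p\<in>Kx. x ^ N dvd l - p}"

lemma Kx_subset_PS: "Kx \<subseteq> PS"
  unfolding PS_def
proof safe
  fix p N assume "p \<in> Kx"
  then show "\<exists>q\<in>Kx. x ^ N dvd p - q" by (intro bexI[of _ p]) simp_all
qed

lemma PS_const: "\<iota> c \<in> PS"
  using Kx_subset_PS Kx.const by blast

lemma PS_0: "0 \<in> PS" and PS_1: "1 \<in> PS"
  using PS_const[of 0] PS_const[of 1] by simp_all

lemma PS_add:
  assumes "l \<in> PS" "l' \<in> PS"
  shows "l + l' \<in> PS"
  unfolding PS_def
proof safe
  fix N
  obtain p p' where p: "p \<in> Kx" "x ^ N dvd l - p" "p' \<in> Kx" "x ^ N dvd l' - p'"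
    using assms unfolding PS_def by blast
  have "l + l' - (p + p') = (l - p) + (l' - p')" by simp
  then have "x ^ N dvd l + l' - (p + p')" using p by (simp only: dvd_add)
  then show "\<exists>p\<in>Kx. x ^ N dvd l + l' - p" using p Kx_add by blast
qed

lemma PS_mult:
  assumes "l \<in> PS" "l' \<in> PS"
  shows "l * l' \<in> PS"
  unfolding PS_def
proof safe
  fix N
  obtain p p' where p: "p \<in> Kx" "x ^ N dvd l - p" "p' \<in> Kx" "x ^ N dvd l' - p'"
    using assms unfolding PS_def by blast
  have "l * l' - p * p' = l * (l' - p') + p' * (l - p)" by (simp add: algebra_simps)
  then have "x ^ N dvd l * l' - p * p'" using p by (simp only: dvd_add dvd_mult)
  then show "\<exists>p\<in>Kx. x ^ N dvd l * l' - p" using p Kx_mult by blast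
qed

lemma PS_uminus: "l \<in> PS \<Longrightarrow> - l \<in> PS"
  using PS_mult[OF PS_const[of "-1"]] by simp

lemma x_dvd_const: "x dvd \<iota> c \<Longrightarrow> c = 0"
proof (rule ccontr)
  assume x: "x dvd \<iota> c" and "c \<noteq> 0"
  then have "\<iota> c * \<iota> (inverse c) = 1" by (metis iota_simps(1,3) right_inverse)
  then have "x dvd 1" using x by (metis dvd_mult2)
  then have "x ^ N dvd 1" for N using dvd_power_same[of x 1 N] by simp
  then show False using x_divisible_eq_0[of 1] by simp
qed

text \<open>Polynomials close to \<open>l\<close> share its constant term by
  \<open>x_dvd_const\<close>. Removing it and cancelling \<open>x\<close>, at the cost of one order
  of precision, gives approximations of \<open>l'\<close>.\<close>

lemma PS_decompose:
  assumes "l \<in> PS"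
  shows "\<exists>c. \<exists>l'\<in>PS. l = \<iota> c + x * l'"
proof -
  have approx: "\<exists>p\<in>Kx. x ^ N dvd l - p" for N using assms unfolding PS_def by blast
  obtain p where p: "p \<in> Kx" "x ^ 1 dvd l - p" using approx by blast
  then obtain t where t: "l - p = x * t" by (auto elim: dvdE)
  obtain c p' where c: "p' \<in> Kx" "p = \<iota> c + x * p'" using Kx_decompose[OF p(1)] by blast
  define l' where "l' = p' + t"
  have l: "l = \<iota> c + x * l'" using t c(2) by (simp add: l'_def algebra_simps)
  have "\<exists>q\<in>Kx. x ^ N dvd l' - q" for N
  proof -
    obtain q where q: "q \<in> Kx" "x ^ Suc N dvd l - q" using approx by blast
    obtain d q' where d: "q' \<in> Kx" "q = \<iota> d + x * q'" using Kx_decompose[OF q(1)] by blast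
    have eq: "l - q = \<iota> (c - d) + x * (l' - q')" by (simp add: l d(2) algebra_simps)
    have "x dvd l - q" using q(2) by (metis dvd_mult_left power_Suc)
    then have "x dvd \<iota> (c - d)" unfolding eq by (simp add: dvd_add_left_iff)
    then have "c - d = 0" by (rule x_dvd_const)
    then have "x * x ^ N dvd x * (l' - q')" using q(2) eq by simp
    then have "x ^ N dvd l' - q'" using x_nonzero by (simp only: dvd_mult_cancel_left) simp
    then show ?thesis using d(1) by blast
  qed
  then have "l' \<in> PS" unfolding PS_def by blast
  then show ?thesis using l by blast
qed

text \<open>Repeated reduction modulo \<open>x\<close> expands \<open>r\<close> in \<open>E\<close>
  with polynomial coefficients; these converge by completeness, so \<open>E\<close> generates
  \<open>R\<close> over \<open>k[[x]]\<close>.\<close>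

lemma PS_span:
  assumes E: "finite E" "UNIV \<subseteq> vs.span ({r. x dvd r} \<union> E)"
  shows "\<exists>a. (\<forall>b\<in>E. a b \<in> PS) \<and> r = (\<Sum>b\<in>E. a b * b)"
proof -
  have "is_ideal {r. x dvd r}" using ring_module.subspace_span[of "{x}"] by (simp only: ideal_gen_singleton)
  then have "\<exists>c. s - (\<Sum>b\<in>E. alg_scale \<iota> (c b) b) \<in> {r. x dvd r}" for s
    using vs.span_finite_subspace_Un[OF ideal_subspace E(1)] E(2) by blast
  then have "\<exists>c t. s = (\<Sum>b\<in>E. \<iota> (c b) * b) + x * t" for s
    unfolding alg_scale_def dvd_def mem_Collect_eq by (metis add.commute diff_add_cancel)
  then obtain C T where CT: "\<And>s. s = (\<Sum>b\<in>E. \<iota> (C s b) * b) + x * T s" by metis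
  \<comment> \<open>\<open>R N\<close> is the remainder after \<open>N\<close> reductions, divided
    by \<open>x ^ N\<close>; \<open>s b N\<close> collects the coefficients of \<open>b\<close>
    found so far.\<close>
  define R where "R N = (T ^^ N) r" for N
  define s where "s b N = (\<Sum>j<N. \<iota> (C (R j) b) * x ^ j)" for b N
  have xpow: "x ^ j \<in> Kx" for j
    by (induction j) (use Kx.const[of 1] Kx_x_mult in auto)
  have s_Kx: "s b N \<in> Kx" for b N
    by (induction N) (use Kx.const[of 0] xpow in \<open>auto simp: s_def intro: Kx_add Kx_const_mult\<close>)
  have r: "r = (\<Sum>b\<in>E. s b N * b) + x ^ N * R N" for N
  proof (induction N)
    case (Suc N)
    have "x ^ N * R N = x ^ N * ((\<Sum>b\<in>E. \<iota> (C (R N) b) * b) + x * T (R N))"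
      using CT[of "R N"] by simp
    also have "\<dots> = (\<Sum>b\<in>E. \<iota> (C (R N) b) * x ^ N * b) + x ^ Suc N * R (Suc N)"
      by (simp add: R_def distrib_left sum_distrib_left mult_ac)
    finally have "x ^ N * R N = (\<Sum>b\<in>E. \<iota> (C (R N) b) * x ^ N * b) + x ^ Suc N * R (Suc N)" .
    moreover have "(\<Sum>b\<in>E. s b (Suc N) * b) = (\<Sum>b\<in>E. s b N * b) + (\<Sum>b\<in>E. \<iota> (C (R N) b) * x ^ N * b)"
      by (simp add: s_def algebra_simps sum.distrib)
    ultimately show ?case using Suc by simp
  qed (simp add: s_def R_def)
  have "s b (Suc i) - s b i \<in> ideal_power m i" for b i
    by (rule x_power_in) (simp add: s_def)
  then have "\<exists>l. \<forall>i. l - s b i \<in> ideal_power m i" for b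
    using complete unfolding adically_complete_def by blast
  then obtain l where l: "\<And>b i. l b - s b i \<in> ideal_power m i" by metis
  obtain k where k: "\<forall>N. \<forall>r\<in>ideal_power m (N + k). x ^ N dvd r" using x_divides_m_power by blast
  \<comment> \<open>The limit is \<open>m\<close>-adic; comparison with the later term
    \<open>s b (N + k)\<close> turns it into divisibility by \<open>x ^ N\<close>.\<close>
  have ls: "x ^ N dvd l b - s b N" for b N
  proof -
    have "x ^ N dvd s b (N + j) - s b N" for j
    proof (induction j)
      case (Suc j)
      have "s b (N + Suc j) - s b N = (s b (N + j) - s b N) + x ^ N * (x ^ j * \<iota> (C (R (N + j)) b))"
        by (simp add: s_def power_add algebra_simps)
      then show ?case using Suc by (simp only: dvd_add dvd_triv_left)
    qed simp
    moreover have "x ^ N dvd l b - s b (N + k)" using k l by blast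
    ultimately have "x ^ N dvd (l b - s b (N + k)) + (s b (N + k) - s b N)" by (rule dvd_add[rotated])
    then show ?thesis by simp
  qed
  have l_PS: "l b \<in> PS" for b unfolding PS_def using ls s_Kx by blast
  have "r - (\<Sum>b\<in>E. l b * b) = 0"
  proof (rule x_divisible_eq_0)
    fix N
    have "r - (\<Sum>b\<in>E. l b * b) = x ^ N * R N - (\<Sum>b\<in>E. (l b - s b N) * b)"
      by (subst r[of N]) (simp add: left_diff_distrib sum_subtractf)
    also have "x ^ N dvd \<dots>" using ls by (intro dvd_diff[OF dvd_triv_left] dvd_sum dvd_mult2)
    finally show "x ^ N dvd r - (\<Sum>b\<in>E. l b * b)" .
  qed
  then have "r = (\<Sum>b\<in>E. l b * b)" by simp
  with l_PS show ?thesis by (intro exI[of _ l]) simp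
qed

lemma PS_dependent:
  fixes r :: "'j \<Rightarrow> 'r"
  assumes E: "finite E" "UNIV \<subseteq> vs.span ({r. x dvd r} \<union> E)" and J: "finite J" "card E < card J"
  shows "\<exists>c. (\<forall>j\<in>J. c j \<in> PS) \<and> (\<exists>j\<in>J. c j \<noteq> 0) \<and> (\<Sum>j\<in>J. c j * r j) = 0"
proof -
  have "\<forall>j. \<exists>a. (\<forall>b\<in>E. a b \<in> PS) \<and> r j = (\<Sum>b\<in>E. a b * b)"
    using PS_span[OF E] by blast
  from choice[OF this] obtain a
    where a: "\<And>j b. b \<in> E \<Longrightarrow> a j b \<in> PS" "\<And>j. r j = (\<Sum>b\<in>E. a j b * b)"
    by blast
  obtain c where c: "\<forall>j\<in>J. c j \<in> PS" "\<exists>j\<in>J. c j \<noteq> 0" "\<forall>b\<in>E. (\<Sum>j\<in>J. c j * a j b) = 0"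
    using nontrivial_left_kernel[of PS E J a, OF PS_0 PS_1 PS_add PS_uminus PS_mult E(1) J a(1)]
    by blast
  have "(\<Sum>j\<in>J. c j * r j) = (\<Sum>b\<in>E. (\<Sum>j\<in>J. c j * a j b) * b)"
    by (simp add: a(2) sum_distrib_left sum_distrib_right sum.swap[of _ J] mult.assoc)
  then show ?thesis using c by auto
qed

text \<open>The kernel of the derivation contains the power series in \<open>x\<close>, over which the ring is
  algebraic.\<close>

lemma derivation_eq_0:
  assumes add: "\<And>a b. d (a + b) = d a + d b" and mult: "\<And>a b. d (a * b) = a * d b + b * d a"
    and const: "\<And>c. d (\<iota> c) = 0" and x: "d x = 0"
  shows "d y = 0"
proof -
  have d_power_x: "d (x ^ N * r) = x ^ N * d r" for N r
    by (induction N) (auto simp: mult x mult.assoc)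
  have d_Kx: "d p = 0" if "p \<in> Kx" for p
    using that by induction (auto simp: add mult const x)
  have d_PS: "d l = 0" if l: "l \<in> PS" for l
  proof (rule x_divisible_eq_0)
    fix N
    obtain p where "p \<in> Kx" "x ^ N dvd l - p" using l unfolding PS_def by blast
    then obtain t where "l = p + x ^ N * t" by (metis add.commute diff_add_cancel dvdE)
    then have "d l = x ^ N * d t" using \<open>p \<in> Kx\<close> by (simp add: add d_Kx d_power_x)
    then show "x ^ N dvd d l" by simp
  qed
  have d_0: "d 0 = 0" using const[of 0] by simp
  have d_sum: "d (sum g A) = (\<Sum>a\<in>A. d (g a))" for g :: "nat \<Rightarrow> 'r" and A
    by (induction A rule: infinite_finite_induct) (auto simp: d_0 add)
  have d_power: "d (y ^ Suc j) = of_nat (Suc j) * y ^ j * d y" for j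
    by (induction j) (auto simp: mult algebra_simps)
  define P where "P n \<longleftrightarrow> (\<exists>c. (\<forall>j\<le>n. c j \<in> PS) \<and> (\<exists>j\<le>n. c j \<noteq> 0) \<and> (\<Sum>j\<le>n. c j * y ^ j) = 0)" for n
  obtain E where E: "finite E" "UNIV \<subseteq> vs.span ({r. x dvd r} \<union> E)" using finite_span_mod_x by blast
  have "P (card E)"
    using PS_dependent[OF E, of "{..card E}" "\<lambda>j. y ^ j"] by (auto simp: P_def)
  define n where "n = (LEAST n. P n)"
  have "P n" unfolding n_def by (rule LeastI) (rule \<open>P (card E)\<close>)
  then obtain c where c: "\<forall>j\<le>n. c j \<in> PS" "\<exists>j\<le>n. c j \<noteq> 0" "(\<Sum>j\<le>n. c j * y ^ j) = 0"
    unfolding P_def by blast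
  have "n \<noteq> 0"
  proof
    assume "n = 0"
    then show False using c(2,3) by simp
  qed
  then obtain n' where n': "n = Suc n'" using not0_implies_Suc by blast
  have not_P: "\<not> P n'" using not_less_Least[of n' P] by (simp add: n_def[symmetric] n')
  have "c n \<noteq> 0"
  proof
    assume "c n = 0"
    then have "P n'" unfolding P_def using c n' by (intro exI[of _ c]) (auto simp: le_Suc_eq)
    then show False using not_P by simp
  qed
  \<comment> \<open>The derivative at \<open>y\<close> of an annihilating polynomial of least
    degree. It is nonzero by minimality and characteristic \<open>0\<close>, and applying
    \<open>d\<close> to the relation gives \<open>e * d y = 0\<close>.\<close>
  define e where "e = (\<Sum>j\<le>n'. of_nat (Suc j) * c (Suc j) * y ^ j)"
  have coeff: "of_nat (Suc j) * c (Suc j) \<in> PS" if "j \<le> n'" for j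
  proof -
    have "of_nat (Suc j) \<in> PS" using PS_const[of "of_nat (Suc j)"] by (simp only: iota_of_nat)
    then show ?thesis using c n' that by (intro PS_mult) auto
  qed
  have leading: "of_nat (Suc n') * c (Suc n') \<noteq> 0"
  proof -
    have "\<iota> (of_nat (Suc n')) \<noteq> 0" unfolding iota_eq_0_iff of_nat_eq_0_iff by simp
    then show ?thesis using \<open>c n \<noteq> 0\<close> n' by (simp only: iota_of_nat mult_eq_0_iff) simp
  qed
  have "e \<noteq> 0"
  proof
    assume "e = 0"
    have "P n'"
      unfolding P_def
    proof (rule exI[of _ "\<lambda>j. of_nat (Suc j) * c (Suc j)"], intro conjI)
      show "\<forall>j\<le>n'. of_nat (Suc j) * c (Suc j) \<in> PS" using coeff by blast
      show "\<exists>j\<le>n'. of_nat (Suc j) * c (Suc j) \<noteq> 0" using leading by blast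
      show "(\<Sum>j\<le>n'. of_nat (Suc j) * c (Suc j) * y ^ j) = 0" using \<open>e = 0\<close> by (simp only: e_def)
    qed
    then show False using not_P by simp
  qed
  have "0 = d (\<Sum>j\<le>n. c j * y ^ j)" using c d_0 by simp
  also have "\<dots> = (\<Sum>j\<le>n. c j * d (y ^ j))"
    using c(1) d_PS by (simp add: d_sum mult)
  also have "\<dots> = (\<Sum>j\<le>n'. c (Suc j) * (of_nat (Suc j) * y ^ j * d y))"
    unfolding n' sum.atMost_Suc_shift d_power using const[of 1] by simp
  also have "\<dots> = e * d y"
    unfolding e_def sum_distrib_right by (intro sum.cong refl) (simp only: mult_ac)
  finally show ?thesis using \<open>e \<noteq> 0\<close> by simp
qed

end

section \<open>The rank of the module of differentials\<close>

text \<open>A basis of \<open>U\<close> stays independent when \<open>y\<close> is added, so a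
  linear form can be \<open>0\<close> on \<open>U\<close> and \<open>1\<close> at \<open>y\<close>;
  \<open>\<delta>\<close> lists its values on the standard basis.\<close>

lemma separating_functional:
  fixes U :: "('a::field ^ 'n::finite) set"
  assumes U: "vec.subspace U" and y: "y \<notin> U"
  obtains \<delta> where "\<And>u. u \<in> U \<Longrightarrow> (\<Sum>i\<in>UNIV. u $ i * \<delta> i) = 0" "(\<Sum>i\<in>UNIV. y $ i * \<delta> i) \<noteq> 0"
proof -
  interpret vector_space_pair "(*s) :: 'a \<Rightarrow> 'a ^ 'n \<Rightarrow> 'a ^ 'n" "(*) :: 'a \<Rightarrow> 'a \<Rightarrow> 'a" ..
  obtain B where B: "B \<subseteq> U" "vec.independent B" "U \<subseteq> vec.span B"
    using vec.maximal_independent_subset by blast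
  have "vec.span B \<subseteq> U" using B(1) U by (rule vec.span_minimal)
  then have "y \<notin> vec.span B" using y by blast
  then have "vec.independent (insert y B)" using B(2) by (simp add: vec.independent_insert)
  then obtain g where g: "Vector_Spaces.linear (*s) (*) g" "\<forall>b\<in>insert y B. g b = (if b = y then 1 else 0)"
    using linear_independent_extend[of "insert y B" "\<lambda>b. if b = y then 1 else 0"] by blast
  interpret g: Vector_Spaces.linear "(*s)" "(*)" g by (rule g(1))
  have expand: "g v = (\<Sum>i\<in>UNIV. v $ i * g (axis i 1))" for v
  proof -
    have "g v = g (\<Sum>i\<in>UNIV. (v $ i) *s axis i 1)" by (simp only: basis_expansion)
    then show ?thesis by (simp only: g.sum g.scale)
  qed
  have "g u = 0" if "u \<in> U" for u
  proof (rule g.eq_0_on_span)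
    show "u \<in> vec.span B" using that B(3) by blast
    show "g b = 0" if "b \<in> B" for b using that g(2) B(1) y by auto
  qed
  moreover have "g y \<noteq> 0" using g(2) by simp
  ultimately show ?thesis
    by (intro that[of "\<lambda>i. g (axis i 1)"]) (simp_all only: expand[symmetric] not_False_eq_True)
qed

lemma common_denominator:
  fixes \<delta> :: "'n::finite \<Rightarrow> 'a::idom fract"
  obtains q d where "q \<noteq> 0" "\<And>i. to_fract q * \<delta> i = to_fract (d i)"
proof -
  have "\<exists>a b. b \<noteq> 0 \<and> to_fract b * \<delta> i = to_fract a" for i
  proof -
    obtain a b where "\<delta> i = Fract a b" "b \<noteq> 0" by (cases "\<delta> i") auto
    then show ?thesis by (intro exI[of _ a] exI[of _ b]) (simp add: Fract_conv_to_fract)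
  qed
  then obtain a b where ab: "\<And>i. b i \<noteq> 0" "\<And>i. to_fract (b i) * \<delta> i = to_fract (a i)" by metis
  define q where "q = (\<Prod>i\<in>UNIV. b i)"
  have "to_fract q * \<delta> i = to_fract ((\<Prod>j\<in>UNIV - {i}. b j) * a i)" for i
  proof -
    have "q = (\<Prod>j\<in>UNIV - {i}. b j) * b i" unfolding q_def by (subst prod.remove[of _ i]) auto
    then show ?thesis by (simp add: ab(2)[symmetric] mult.assoc)
  qed
  moreover have "q \<noteq> 0" using ab(1) by (simp add: q_def)
  ultimately show ?thesis using that[of q "\<lambda>i. (\<Prod>j\<in>UNIV - {i}. b j) * a i"] by simp
qed

context presented_curve
begin

abbreviation J :: "'r ^ 'm ^ 'n" where
  "J \<equiv> jacobian_matrix \<phi> f"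

text \<open>Represents the differential of \<open>\<phi> p\<close>; by \<open>N_eq\<close> its class
  modulo \<open>N\<close> depends on \<open>\<phi> p\<close> only.\<close>

definition grad :: "('k, 'n) mfps \<Rightarrow> 'r ^ 'n" where
  "grad p = (\<chi> i. \<phi> (mfps_pderiv i p))"

lemma grad_simps:
  "grad (p + q) = grad p + grad q" "grad (p - q) = grad p - grad q" "grad 0 = 0"
  "grad (mfps_const c) = 0" "grad (mfps_const c * p) = \<iota> c *s grad p"
  by (simp_all add: grad_def vec_eq_iff)

lemma grad_mult: "grad (p * q) = \<phi> p *s grad q + \<phi> q *s grad p"
  by (simp add: grad_def vec_eq_iff pderiv_mult)

lemma grad_sum: "grad (sum g A) = (\<Sum>a\<in>A. grad (g a))"
  by (induction A rule: infinite_finite_induct) (simp_all add: grad_simps)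

definition N :: "('r ^ 'n) set" where
  "N = range ((*v) J)"

lemma N_smult: "v \<in> N \<Longrightarrow> r *s v \<in> N"
proof -
  have "r *s (J *v c) = J *v (r *s c)" for c
    by (simp add: vec_eq_iff matrix_vector_mult_def sum_distrib_left algebra_simps)
  then show "v \<in> N \<Longrightarrow> r *s v \<in> N" unfolding N_def by blast
qed

lemma N_add: "v \<in> N \<Longrightarrow> w \<in> N \<Longrightarrow> v + w \<in> N"
proof -
  have "J *v c + J *v d = J *v (c + d)" for c d
    by (simp add: vec_eq_iff matrix_vector_mult_def sum.distrib algebra_simps)
  then show "v \<in> N \<Longrightarrow> w \<in> N \<Longrightarrow> v + w \<in> N" unfolding N_def by auto
qed

lemma N_0: "0 \<in> N"
proof -
  have "J *v 0 = 0" by (simp add: vec_eq_iff matrix_vector_mult_def)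
  then show ?thesis unfolding N_def by (metis rangeI)
qed

lemma N_diff: "v \<in> N \<Longrightarrow> w \<in> N \<Longrightarrow> v - w \<in> N"
proof -
  have eq: "v - w = v + (-1) *s w" by (simp add: vec_eq_iff)
  show "v \<in> N \<Longrightarrow> w \<in> N \<Longrightarrow> v - w \<in> N" unfolding eq by (intro N_add N_smult)
qed

lemma N_sum: "(\<And>a. a \<in> A \<Longrightarrow> g a \<in> N) \<Longrightarrow> sum g A \<in> N"
  by (induction A rule: infinite_finite_induct) (auto intro: N_0 N_add)

text \<open>With lifts \<open>p j\<close> of the entries of \<open>c\<close>, the product rule for
  \<open>p j * f $ j\<close> loses the term containing \<open>\<phi> (f $ j)\<close>, so
  \<open>J *v c\<close> is the gradient of a kernel element. The converse is an induction over the
  ideal.\<close>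

lemma N_eq: "N = grad ` {p. \<phi> p = 0}"
proof (rule antisym)
  show "N \<subseteq> grad ` {p. \<phi> p = 0}"
    unfolding N_def
  proof safe
    fix c :: "'r ^ 'm"
    have f0: "\<phi> (f $ j) = 0" for j
      unfolding ker_phi by (rule ring_module.span_base) simp
    have "\<forall>j. \<exists>p. \<phi> p = c $ j" using phi_surj by metis
    from choice[OF this] obtain p where p: "\<And>j. \<phi> (p j) = c $ j" by blast
    let ?s = "\<Sum>j\<in>UNIV. p j * f $ j"
    have "grad ?s = (\<Sum>j\<in>UNIV. c $ j *s grad (f $ j))"
      by (simp add: grad_sum grad_mult p f0)
    also have "\<dots> = J *v c"
      by (simp add: vec_eq_iff matrix_vector_mult_def jacobian_matrix_def grad_def mult.commute)
    finally have "J *v c = grad ?s" by (rule sym)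
    moreover have "\<phi> ?s = 0" by (simp add: phi_sum f0)
    ultimately show "J *v c \<in> grad ` {p. \<phi> p = 0}" by blast
  qed
  have "grad p \<in> N" if "p \<in> ideal_gen (range (($) f))" for p
    using that
  proof (induction rule: ring_module.span_induct_alt)
    case base
    then show ?case by (simp add: grad_simps N_0)
  next
    case (step c p q)
    then obtain j where j: "p = f $ j" by blast
    have "grad p = J *v axis j 1"
      by (simp add: j vec_eq_iff matrix_vector_mult_def jacobian_matrix_def grad_def axis_def
          if_distrib cong: if_cong)
    then have "grad p \<in> N" unfolding N_def by simp
    moreover have "\<phi> p = 0" unfolding ker_phi by (rule ring_module.span_base) (simp add: j)
    ultimately show ?case using step.IH by (simp add: grad_simps(1) grad_mult N_add N_smult)
  qed
  then show "grad ` {p. \<phi> p = 0} \<subseteq> N" by (auto simp: ker_phi)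
qed

text \<open>A linear form over the fraction field that vanishes on the relations and on the differential
  of \<open>x\<close> gives, after clearing denominators, a derivation that kills \<open>x\<close>.\<close>

lemma derivation_of_functional:
  assumes ker: "\<And>v. v \<in> N \<Longrightarrow> (\<Sum>i\<in>UNIV. v $ i * d i) = 0"
    and x: "(\<Sum>i\<in>UNIV. grad X $ i * d i) = 0"
  shows "d i = 0"
proof -
  define T where "T p = (\<Sum>i\<in>UNIV. grad p $ i * d i)" for p
  have T_simps: "T (p + q) = T p + T q" "T (p - q) = T p - T q" "T (mfps_const c) = 0"
    "T (p * q) = \<phi> p * T q + \<phi> q * T p" for p q c
    by (simp_all add: T_def grad_simps(1-4) grad_mult distrib_right left_diff_distrib sum.distrib
        sum_subtractf sum_distrib_left mult.assoc)
  have T_ker: "T p = 0" if "\<phi> p = 0" for p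
    unfolding T_def by (rule ker) (use that N_eq in blast)
  \<comment> \<open>\<open>T\<close> kills the kernel of \<open>\<phi>\<close>, so evaluating it on
    arbitrary lifts yields a derivation of \<open>R\<close>.\<close>
  define L where "L r = (SOME p. \<phi> p = r)" for r
  have L: "\<phi> (L r) = r" for r
    unfolding L_def by (rule someI_ex) (use phi_surj in metis)
  define D where "D r = T (L r)" for r
  have D_phi: "D (\<phi> p) = T p" for p
    using T_ker[of "L (\<phi> p) - p"] by (simp add: L D_def T_simps)
  have "D r = 0" for r
  proof (rule derivation_eq_0[of D])
    show "D (a + b) = D a + D b" for a b
      using D_phi[of "L a + L b"] by (simp add: L T_simps D_def)
    show "D (a * b) = a * D b + b * D a" for a b
      using D_phi[of "L a * L b"] by (simp add: L T_simps D_def)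
    show "D (\<iota> c) = 0" for c
      using D_phi[of "mfps_const c"] by (simp add: T_simps)
    show "D x = 0"
      using D_phi[of X] x by (simp add: X T_def)
  qed
  then have "T (mfps_var i) = 0" using D_phi by metis
  then show ?thesis
    by (simp add: T_def grad_def pderiv_var if_distrib if_distribR cong: if_cong)
qed

text \<open>Otherwise a linear form over the fraction field would vanish on \<open>N\<close> and on
  \<open>grad X\<close> but not on \<open>w\<close>, against
  \<open>derivation_of_functional\<close>.\<close>

lemma rank_one: "\<exists>q r. q \<noteq> 0 \<and> q *s w - r *s grad X \<in> N"
proof -
  define emb :: "'r ^ 'n \<Rightarrow> 'r fract ^ 'n" where "emb v = (\<chi> i. to_fract (v $ i))" for v
  have emb_simps: "emb (u + v) = emb u + emb v" "emb (r *s u) = to_fract r *s emb u" for u v r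
    by (simp_all add: emb_def vec_eq_iff)
  \<comment> \<open>The span of \<open>N\<close> and \<open>grad X\<close> over the fraction field,
    with denominators cleared.\<close>
  define U where "U = {y. \<exists>q r v. q \<noteq> 0 \<and> v \<in> N \<and> to_fract q *s y = emb (r *s grad X + v)}"
  have UI: "y \<in> U" if "q \<noteq> 0" "v \<in> N" "to_fract q *s y = emb (r *s grad X + v)" for q r v y
    using that unfolding U_def by blast
  have "vec.subspace U"
  proof (rule vec.subspaceI)
    show "0 \<in> U" by (rule UI[of 1 0 _ 0]) (simp_all add: N_0 emb_def vec_eq_iff)
  next
    fix y z assume "y \<in> U" "z \<in> U"
    then obtain q r v q' r' v' where yz: "q \<noteq> 0" "v \<in> N" "to_fract q *s y = emb (r *s grad X + v)"
      "q' \<noteq> 0" "v' \<in> N" "to_fract q' *s z = emb (r' *s grad X + v')"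
      unfolding U_def by blast
    show "y + z \<in> U"
    proof (rule UI[of "q * q'" "q' *s v + q *s v'" _ "q' * r + q * r'"])
      have "to_fract (q * q') *s (y + z) =
          to_fract q' *s (to_fract q *s y) + to_fract q *s (to_fract q' *s z)"
        by (simp add: vec_eq_iff algebra_simps)
      also have "\<dots> = emb ((q' * r + q * r') *s grad X + (q' *s v + q *s v'))"
        unfolding yz by (simp add: emb_def vec_eq_iff algebra_simps)
      finally show "to_fract (q * q') *s (y + z) = emb ((q' * r + q * r') *s grad X + (q' *s v + q *s v'))" .
    qed (use yz in \<open>auto intro: N_add N_smult\<close>)
  next
    fix c :: "'r fract" and y assume "y \<in> U"
    then obtain q r v where y: "q \<noteq> 0" "v \<in> N" "to_fract q *s y = emb (r *s grad X + v)"
      unfolding U_def by blast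
    obtain a b where c: "c = Fract a b" "b \<noteq> 0" by (cases c)
    show "c *s y \<in> U"
    proof (rule UI[of "b * q" "a *s v" _ "a * r"])
      have "to_fract b * c = to_fract a" using c by (simp add: Fract_conv_to_fract)
      then have "to_fract (b * q) *s (c *s y) = to_fract a *s (to_fract q *s y)"
        by (simp add: vec_eq_iff)
      also have "\<dots> = emb ((a * r) *s grad X + a *s v)"
        unfolding y by (simp add: emb_def vec_eq_iff algebra_simps)
      finally show "to_fract (b * q) *s (c *s y) = emb ((a * r) *s grad X + a *s v)" .
    qed (use y c in \<open>auto intro: N_smult\<close>)
  qed
  have "emb w \<in> U"
  proof (rule ccontr)
    assume "emb w \<notin> U"
    then obtain \<delta> where \<delta>: "\<And>u. u \<in> U \<Longrightarrow> (\<Sum>i\<in>UNIV. u $ i * \<delta> i) = 0"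
        "(\<Sum>i\<in>UNIV. emb w $ i * \<delta> i) \<noteq> 0"
      using separating_functional[OF \<open>vec.subspace U\<close>] by metis
    obtain q d where qd: "q \<noteq> 0" "\<And>i. to_fract q * \<delta> i = to_fract (d i)"
      using common_denominator[of \<delta>] by metis
    have d: "(\<Sum>i\<in>UNIV. v $ i * d i) = 0" if "emb v \<in> U" for v
    proof -
      have "to_fract (\<Sum>i\<in>UNIV. v $ i * d i) = to_fract q * (\<Sum>i\<in>UNIV. emb v $ i * \<delta> i)"
        by (simp add: emb_def sum_distrib_left qd(2)[symmetric] algebra_simps)
      also have "\<dots> = 0" using \<delta>(1)[OF that] by simp
      finally show ?thesis by (simp only: to_fract_eq_0_iff)
    qed
    have "d i = 0" for i
    proof (rule derivation_of_functional)
      show "(\<Sum>i\<in>UNIV. v $ i * d i) = 0" if "v \<in> N" for v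
        by (rule d, rule UI[of 1 v _ 0]) (simp_all add: that)
      show "(\<Sum>i\<in>UNIV. grad X $ i * d i) = 0"
        by (rule d, rule UI[of 1 0 _ 1]) (simp_all add: N_0)
    qed
    then have "\<delta> i = 0" for i using qd by (metis mult_eq_0_iff to_fract_0 to_fract_eq_0_iff)
    then show False using \<delta>(2) by simp
  qed
  then obtain q r v where "q \<noteq> 0" "v \<in> N" "to_fract q *s emb w = emb (r *s grad X + v)"
    unfolding U_def by blast
  then have "emb (q *s w) = emb (r *s grad X + v)" by (simp only: emb_simps)
  then have "q *s w = r *s grad X + v"
    by (simp only: emb_def vec_eq_iff vec_lambda_beta to_fract_eq_iff simp_thms)
  then have "q *s w - r *s grad X = v" by simp
  then show ?thesis using \<open>q \<noteq> 0\<close> \<open>v \<in> N\<close> by blast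
qed

text \<open>Since the fraction field has the same dimension over that of \<open>k[[x]]\<close> as \<open>R/(x)\<close> over
  \<open>k\<close>, a torsion-free module of rank one has at most that many generators modulo \<open>x\<close>. Relations
  over \<open>k[[x]]\<close> are divided by powers of \<open>x\<close> until they stay nontrivial modulo \<open>x\<close>.\<close>

lemma torsion_free_dependent:
  fixes w :: "'j \<Rightarrow> 'r ^ 'n"
  assumes tf: "\<And>r v. r \<noteq> 0 \<Longrightarrow> r *s v \<in> N \<Longrightarrow> v \<in> N"
    and E: "finite E" "UNIV \<subseteq> vs.span ({r. x dvd r} \<union> E)" and I: "finite I" "card E < card I"
  shows "\<exists>\<beta> v. (\<exists>j\<in>I. \<beta> j \<noteq> 0) \<and> (\<Sum>j\<in>I. \<iota> (\<beta> j) *s w j) - x *s v \<in> N"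
proof -
  have "\<forall>j. \<exists>qr. fst qr \<noteq> 0 \<and> fst qr *s w j - snd qr *s grad X \<in> N"
    using rank_one by (metis fst_conv snd_conv)
  from choice[OF this] obtain qr
    where qr: "\<And>j. fst (qr j) \<noteq> 0" "\<And>j. fst (qr j) *s w j - snd (qr j) *s grad X \<in> N"
    by blast
  define q where "q = (\<Prod>j\<in>I. fst (qr j))"
  have "q \<noteq> 0" using qr(1) I by (simp add: q_def)
  define r where "r j = (\<Prod>i\<in>I - {j}. fst (qr i)) * snd (qr j)" for j
  have qw: "q *s w j - r j *s grad X \<in> N" if "j \<in> I" for j
  proof -
    let ?p = "\<Prod>i\<in>I - {j}. fst (qr i)"
    have "q = ?p * fst (qr j)" using I that by (simp add: q_def prod.remove mult.commute)
    then have eq: "q *s w j - r j *s grad X = ?p *s (fst (qr j) *s w j - snd (qr j) *s grad X)"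
      by (simp add: r_def vec_eq_iff algebra_simps)
    show ?thesis unfolding eq by (rule N_smult[OF qr(2)])
  qed
  obtain c where c: "\<forall>j\<in>I. c j \<in> PS" "\<exists>j\<in>I. c j \<noteq> 0" "(\<Sum>j\<in>I. c j * r j) = 0"
    using PS_dependent[OF E I] by blast
  have "q *s (\<Sum>j\<in>I. c j *s w j) = (\<Sum>j\<in>I. c j *s (q *s w j - r j *s grad X)) + (\<Sum>j\<in>I. c j * r j) *s grad X"
    by (simp add: vec_eq_iff sum_component sum_distrib_left sum_distrib_right sum.distrib[symmetric]
        algebra_simps)
  also have "\<dots> \<in> N" unfolding c(3) by (intro N_add N_sum N_smult[OF qw]) (simp_all add: N_0)
  finally have cw: "(\<Sum>j\<in>I. c j *s w j) \<in> N" by (rule tf[OF \<open>q \<noteq> 0\<close>])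
  obtain j0 where j0: "j0 \<in> I" "c j0 \<noteq> 0" using c(2) by blast
  \<comment> \<open>While \<open>x\<close> divides every coefficient, the relation is divided by
    \<open>x\<close>, as torsion-freeness permits, and \<open>K\<close> drops by one.\<close>
  then obtain K where "\<not> x ^ K dvd c j0" using x_divisible_eq_0 by blast
  then have "\<exists>c. (\<forall>j\<in>I. c j \<in> PS) \<and> (\<exists>j\<in>I. \<not> x dvd c j) \<and> (\<Sum>j\<in>I. c j *s w j) \<in> N"
    using c(1) cw
  proof (induction K arbitrary: c)
    case (Suc K)
    show ?case
    proof (cases "\<exists>j\<in>I. \<not> x dvd c j")
      case False
      have "\<exists>l'. l' \<in> PS \<and> c j = x * l'" if "j \<in> I" for j
      proof -
        obtain a l' where l': "l' \<in> PS" "c j = \<iota> a + x * l'"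
          using PS_decompose Suc.prems(2) \<open>j \<in> I\<close> by blast
        moreover have "x dvd c j" using False that by blast
        ultimately have "x dvd \<iota> a" by (simp add: dvd_add_left_iff)
        then have "a = 0" by (rule x_dvd_const)
        then show ?thesis using l' by auto
      qed
      then obtain c' where c': "\<And>j. j \<in> I \<Longrightarrow> c' j \<in> PS" "\<And>j. j \<in> I \<Longrightarrow> c j = x * c' j" by metis
      have "\<not> x ^ K dvd c' j0" using Suc.prems(1) c'(2)[OF j0(1)] by (auto intro: mult_dvd_mono)
      moreover have "x *s (\<Sum>j\<in>I. c' j *s w j) = (\<Sum>j\<in>I. c j *s w j)"
        using c'(2) by (simp add: vec_eq_iff sum_component sum_distrib_left mult.assoc)
      then have "(\<Sum>j\<in>I. c' j *s w j) \<in> N" using Suc.prems(3) tf[OF x_nonzero] by simp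
      ultimately show ?thesis using Suc.IH[of c'] c'(1) by blast
    qed (use Suc.prems in blast)
  qed simp
  then obtain c where c: "\<forall>j\<in>I. c j \<in> PS" "\<exists>j\<in>I. \<not> x dvd c j" "(\<Sum>j\<in>I. c j *s w j) \<in> N" by blast
  have "\<exists>b t. j \<in> I \<longrightarrow> c j = \<iota> b + x * t" for j using c(1) PS_decompose by blast
  then obtain b t where bt: "\<And>j. j \<in> I \<Longrightarrow> c j = \<iota> (b j) + x * t j" by metis
  have "\<exists>j\<in>I. b j \<noteq> 0"
  proof -
    obtain j where j: "j \<in> I" "\<not> x dvd c j" using c(2) by blast
    then have "b j \<noteq> 0" using bt[OF j(1)] by auto
    then show ?thesis using j(1) by blast
  qed
  moreover have "(\<Sum>j\<in>I. \<iota> (b j) *s w j) - x *s - (\<Sum>j\<in>I. t j *s w j) = (\<Sum>j\<in>I. c j *s w j)"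
    by (simp add: bt vec_eq_iff sum_component sum_distrib_left sum.distrib algebra_simps)
  ultimately show ?thesis using c(3) by metis
qed

end

section \<open>Linear independence of differentials modulo \<open>x\<close>\<close>

text \<open>The square of \<open>A\<close> consists of the oriented pairs, their mirror images and
  the diagonal. The injection \<open>h\<close> stands in for a linear order.\<close>

lemma card_oriented_pairs:
  fixes h :: "'a \<Rightarrow> nat"
  assumes "finite A" "inj_on h A"
  shows "2 * card {(a, b). a \<in> A \<and> b \<in> A \<and> h a < h b} + card A = card A * card A"
proof -
  let ?P = "{(a, b). a \<in> A \<and> b \<in> A \<and> h a < h b}"
  let ?D = "(\<lambda>a. (a, a)) ` A"
  have fin: "finite ?P" by (rule finite_subset[of _ "A \<times> A"]) (use assms in auto)
  have AA: "A \<times> A = (?P \<union> prod.swap ` ?P) \<union> ?D"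
    using assms(2) by (auto simp: inj_on_def image_iff)
  have "card ((?P \<union> prod.swap ` ?P) \<union> ?D) = card (?P \<union> prod.swap ` ?P) + card ?D"
    by (rule card_Un_disjoint) (use fin assms in auto)
  moreover have "card (?P \<union> prod.swap ` ?P) = card ?P + card (prod.swap ` ?P)"
    by (rule card_Un_disjoint) (use fin in auto)
  moreover have "card (prod.swap ` ?P) = card ?P" by (simp add: card_image)
  moreover have "card ?D = card A" by (simp add: card_image inj_on_def)
  ultimately have "card (A \<times> A) = card ?P + card ?P + card A" unfolding AA by (simp only:)
  then show ?thesis by (simp only: card_cartesian_product mult_2)
qed

context presented_curve
begin

text \<open>The linear parts of the congruence say that the Hessian of \<open>g\<close> plus the matrix \<open>\<Gamma>\<close> is a
  matrix \<open>lin\<^sub>j \<alpha>\<^sub>i\<close> of rank one. By the symmetry of the Hessian, \<open>\<Gamma>\<close> vanishes and the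
  Hessian is a multiple of that of \<open>X\<^sup>2\<close>. After subtracting this multiple of \<open>X\<^sup>2\<close>, the Euler
  relation recovers \<open>g\<close> from its gradient up to order four.\<close>

lemma differentials_independent_mod_x:
  fixes g :: "('k, 'n) mfps" and \<Gamma> :: "'n \<Rightarrow> 'n \<Rightarrow> 'k" and v :: "'r ^ 'n"
  assumes o: "lin o' \<noteq> 0"
    and \<Gamma>: "\<And>i. \<Gamma> i o' = 0" "\<And>j. \<Gamma> o' j = 0" "\<And>i j. \<Gamma> i j = 0 \<or> \<Gamma> j i = 0"
    and eq: "\<And>i. \<phi> (mfps_pderiv i g) + (\<Sum>j\<in>UNIV. \<iota> (\<Gamma> i j) * \<phi> (mfps_var j)) = x * v $ i"
    and W: "vs.subspace W" "{r. x dvd r} \<subseteq> W" "ideal_power m 4 \<subseteq> W"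
  shows "\<Gamma> i j = 0" and "mfps_coeff g (axis i 1) = 0" and "\<phi> g - \<iota> (mfps_coeff g 0) \<in> W"
proof -
  have "\<forall>i. \<exists>p. \<phi> p = v $ i" using phi_surj by metis
  from choice[OF this] obtain V where V: "\<And>i. \<phi> (V i) = v $ i" by blast
  \<comment> \<open>The congruence lifted to power series: \<open>Z i\<close> lies in the kernel, so
    its constant and linear coefficients vanish.\<close>
  define Z where
    "Z i = mfps_pderiv i g + (\<Sum>j\<in>UNIV. mfps_const (\<Gamma> i j) * mfps_var j) - X * V i" for i
  have "\<phi> (Z i) = 0" for i
    using eq[of i] by (simp add: Z_def phi_sum V X)
  then have Z2: "Z i \<in> order_ge 2" for i by (rule ker_phi_order)
  have Z_coeff: "mfps_coeff (Z i) 0 = 0" "mfps_coeff (mfps_pderiv j (Z i)) 0 = 0" for i j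
  proof -
    have "mdeg (0 :: nat ^ 'n) < 2" "mdeg (axis j 1 :: nat ^ 'n) < 2" by simp_all
    then have "mfps_coeff (Z i) 0 = 0" "mfps_coeff (Z i) (axis j 1) = 0"
      using Z2[of i] unfolding order_ge_def by blast+
    then show "mfps_coeff (Z i) 0 = 0" "mfps_coeff (mfps_pderiv j (Z i)) 0 = 0" by simp_all
  qed
  define H where "H j i = mfps_coeff (mfps_pderiv j (mfps_pderiv i g)) 0" for i j
  have H_sym: "H i j = H j i" for i j
    unfolding H_def by (subst pderiv_commute) (rule refl)
  define \<alpha> where "\<alpha> i = mfps_coeff (V i) 0" for i
  have lin_eq: "mfps_coeff (mfps_pderiv j X) 0 = lin j" for j
    by (simp add: lin_def)
  have pd_one: "mfps_coeff (mfps_pderiv j (mfps_var l)) 0 = (if j = l then 1 else (0 :: 'k))" for j l :: 'n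
    by (simp only: pderiv_var) simp
  have lin0: "mfps_coeff (mfps_pderiv i g) 0 = 0" for i
    using Z_coeff(1)[of i] X(1) by (simp only: Z_def coeff_simps(3,4) coeff_sum coeff_const_mult
        coeff_mult_0 coeff_var_0) simp
  have "mfps_coeff (mfps_pderiv j (Z i)) 0 = H j i + \<Gamma> i j - lin j * \<alpha> i" for i j
    unfolding Z_def pderiv_simps pderiv_sum pderiv_const_mult pderiv_mult[of j X]
      coeff_simps(3,4) coeff_sum coeff_const_mult coeff_mult_0 lin_eq pd_one X(1) H_def \<alpha>_def
    by (simp add: if_distrib mult.commute cong: if_cong)
  then have main: "H j i + \<Gamma> i j = lin j * \<alpha> i" for i j
    using Z_coeff(2)[of j i] by simp
  \<comment> \<open>Row and column \<open>o'\<close> of \<open>\<Gamma>\<close> vanish, so there the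
    symmetry of the Hessian forces \<open>\<alpha>\<close> to be proportional to
    \<open>lin\<close>.\<close>
  define c where "c = \<alpha> o' / lin o'"
  have \<alpha>: "\<alpha> i = c * lin i" for i
  proof -
    have "lin o' * \<alpha> i = lin i * \<alpha> o'"
      using main[of o' i] main[of i o'] H_sym[of o' i] \<Gamma>(1)[of i] \<Gamma>(2)[of i] by simp
    then show ?thesis using o by (simp add: c_def field_simps)
  qed
  have \<Gamma>0: "\<Gamma> i j = 0" for i j
  proof -
    have "H j i + \<Gamma> i j = H j i + \<Gamma> j i"
      using main[of j i] main[of i j] H_sym[of i j] by (simp add: \<alpha> algebra_simps)
    then have "\<Gamma> i j = \<Gamma> j i" by (rule add_left_imp_eq)
    then show ?thesis using \<Gamma>(3)[of i j] by auto
  qed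
  then show "\<Gamma> i j = 0" .
  show "mfps_coeff g (axis i 1) = 0" using lin0[of i] by simp
  have H: "H j i = c * lin i * lin j" for i j
    using main[of j i] by (simp add: \<Gamma>0 \<alpha>)
  \<comment> \<open>Subtracting \<open>c / 2\<close> times \<open>X * X\<close> cancels the Hessian
    and changes the gradient only by multiples of \<open>x\<close>.\<close>
  define G where "G = g - mfps_const (mfps_coeff g 0) - mfps_const (c / 2) * (X * X)"
  have dG: "mfps_pderiv i G = mfps_pderiv i g - mfps_const c * (X * mfps_pderiv i X)" for i
  proof -
    have "mfps_const (c / 2) * (X * Y + X * Y) = mfps_const c * (X * Y)" for Y :: "('k, 'n) mfps"
      by (rule mfps_eqI) (simp only: coeff_const_mult coeff_simps(3), simp)
    then show ?thesis by (simp only: G_def pderiv_simps pderiv_mult pderiv_const_mult) simp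
  qed
  have G3: "G \<in> order_ge (Suc (Suc (Suc 0)))"
  proof (rule order_ge_Suc_pderivI)
    show "mfps_coeff G 0 = 0" using X(1) by (simp add: G_def)
    fix i
    show "mfps_pderiv i G \<in> order_ge (Suc (Suc 0))"
    proof (rule order_ge_Suc_pderivI)
      show "mfps_coeff (mfps_pderiv i G) 0 = 0"
        unfolding dG coeff_simps(4) lin0 coeff_const_mult coeff_mult_0 X(1) by simp
      fix j
      have "mfps_coeff (mfps_pderiv j (mfps_pderiv i G)) 0 = H j i - c * (lin i * lin j)"
        unfolding dG pderiv_simps pderiv_const_mult pderiv_mult[of j X] coeff_simps(3,4)
          coeff_const_mult coeff_mult_0 lin_eq X(1) H_def by simp
      then show "mfps_pderiv j (mfps_pderiv i G) \<in> order_ge (Suc 0)"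
        by (simp only: order_ge_Suc_0_iff H) simp
    qed
  qed
  have "(\<Sum>i\<in>UNIV. mfps_var i * mfps_pderiv i G) - of_nat 3 * G \<in> order_ge 4"
    using Euler_order[of G 3] G3 by (simp only: numeral_3_eq_3 eval_nat_numeral BitM.simps)
  then have "\<phi> ((\<Sum>i\<in>UNIV. mfps_var i * mfps_pderiv i G) - of_nat 3 * G) \<in> W"
    using W(3) unfolding m_power_eq by blast
  moreover have "\<phi> (\<Sum>i\<in>UNIV. mfps_var i * mfps_pderiv i G) \<in> W"
  proof -
    have "x dvd \<phi> (mfps_pderiv i G)" for i
      using eq[of i] by (simp add: dG \<Gamma>0 X)
    then have "x dvd \<phi> (\<Sum>i\<in>UNIV. mfps_var i * mfps_pderiv i G)"
      by (simp only: phi_sum phi_simps) (intro dvd_sum dvd_mult)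
    then show ?thesis using W(2) by blast
  qed
  ultimately have "\<phi> (of_nat 3 * G) \<in> W"
    using vs.subspace_diff[OF W(1)] by (metis phi_simps(6) diff_diff_eq2 add_diff_cancel_left')
  moreover have "\<phi> (of_nat 3 * G) = alg_scale \<iota> 3 (\<phi> G)"
  proof -
    have "\<phi> (of_nat K) = \<iota> (of_nat K)" for K by (induction K) simp_all
    from this[of 3] show ?thesis by (simp only: alg_scale_def phi_simps(3) of_nat_numeral)
  qed
  ultimately have "alg_scale \<iota> (1 / 3) (alg_scale \<iota> 3 (\<phi> G)) \<in> W"
    using W(1) by (simp only: vs.subspace_scale)
  then have GW: "\<phi> G \<in> W" by simp
  have "x * (\<iota> (c / 2) * x) \<in> W" using W(2) by auto
  with GW have "\<phi> G + x * (\<iota> (c / 2) * x) \<in> W" by (rule vs.subspace_add[OF W(1)])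
  then show "\<phi> g - \<iota> (mfps_coeff g 0) \<in> W" by (simp add: G_def X algebra_simps)
qed

text \<open>The spanning set \<open>E\<close> modulo \<open>x\<close> has at most
  \<open>card B + 1 + card C\<close> elements, the family \<open>w\<close> has
  \<open>card C + 1 + card P\<close>. Without torsion \<open>w\<close> would be dependent modulo
  \<open>x\<close>, which \<open>differentials_independent_mod_x\<close> excludes.\<close>

lemma torsion_of_codimension_bound:
  assumes W: "vs.subspace W" "{r. x dvd r} \<subseteq> W" "ideal_power m 4 \<subseteq> W"
    and B: "finite B" "W \<subseteq> vs.span ({r. x dvd r} \<union> B)"
    and card: "2 * (card B + 1) \<le> (CARD('n) - 1) * (CARD('n) - 2)"
  shows "\<exists>r v. r \<noteq> 0 \<and> r *s v \<in> N \<and> v \<notin> N"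
proof (rule ccontr)
  assume "\<nexists>r v. r \<noteq> 0 \<and> r *s v \<in> N \<and> v \<notin> N"
  then have tf: "\<And>r v. r \<noteq> 0 \<Longrightarrow> r *s v \<in> N \<Longrightarrow> v \<in> N" by blast
  let ?xR = "{r. x dvd r}"
  \<comment> \<open>Constants are adjoined because their differentials are zero.\<close>
  define W1 where "W1 = vs.span (insert 1 W)"
  have W1: "vs.subspace W1" "W \<subseteq> W1" "1 \<in> W1"
    unfolding W1_def using vs.span_superset[of "insert 1 W"] by (auto simp: vs.subspace_span)
  obtain C where C: "quotient_basis (alg_scale \<iota>) UNIV W1 C"
    using vs.quotient_basis_exists[of UNIV W1] W1(1) by auto
  have C_span: "UNIV \<subseteq> vs.span (W1 \<union> C)" using C unfolding quotient_basis_def by blast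
  define E where "E = insert 1 B \<union> C"
  have "finite C"
  proof -
    obtain F where F: "finite F" "UNIV \<subseteq> vs.span (?xR \<union> F)" using finite_span_mod_x by blast
    have "vs.span (?xR \<union> F) \<subseteq> vs.span (W1 \<union> F)" by (rule vs.span_mono) (use W(2) W1(2) in auto)
    then have "UNIV \<subseteq> vs.span (W1 \<union> F)" using F(2) by blast
    from vs.quotient_basis_finite[OF C W1(1) F(1) this] show ?thesis .
  qed
  then have E: "finite E" using B(1) by (simp add: E_def)
  have E_span: "UNIV \<subseteq> vs.span (?xR \<union> E)"
  proof -
    let ?S = "vs.span (?xR \<union> E)"
    have "vs.span (?xR \<union> B) \<subseteq> ?S" by (rule vs.span_mono) (auto simp: E_def)
    then have "W \<subseteq> ?S" using B(2) by blast
    moreover have "1 \<in> ?S" by (rule vs.span_base) (simp add: E_def)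
    ultimately have "W1 \<subseteq> ?S" unfolding W1_def by (intro vs.span_minimal) auto
    moreover have "C \<subseteq> ?S" using vs.span_superset[of "?xR \<union> E"] by (auto simp: E_def)
    ultimately have "vs.span (W1 \<union> C) \<subseteq> ?S" by (intro vs.span_minimal) auto
    then show ?thesis using C_span by blast
  qed
  obtain o' where o: "lin o' \<noteq> 0" using lin_nonzero by blast
  obtain h :: "'n \<Rightarrow> nat" where h: "inj_on h UNIV"
    using finite_imp_inj_to_nat_seg[of "UNIV :: 'n set"] by auto
  \<comment> \<open>Omitting \<open>o'\<close> leaves variables that generate \<open>m\<close>
    together with \<open>x\<close>, and provides the zero row and column of
    \<open>\<Gamma>\<close>.\<close>
  define A where "A = UNIV - {o'}"
  define P where "P = {(a, b). a \<in> A \<and> b \<in> A \<and> h a < h b}"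
  have "finite P" by (rule finite_subset[of _ UNIV]) auto
  have "card A = CARD('n) - 1" by (simp add: A_def card_Diff_singleton)
  moreover have "2 * card P + card A = card A * card A"
    unfolding P_def by (rule card_oriented_pairs) (use h in \<open>auto intro: inj_on_subset\<close>)
  ultimately have "2 * card P = (CARD('n) - 1) * (CARD('n) - 2)"
    by (cases "CARD('n)") (auto simp: diff_mult_distrib2 algebra_simps)
  then have "2 * (card B + 1) \<le> 2 * card P" using card by (simp only:)
  then have card_P: "card B + 1 \<le> card P" by simp
  have "x \<notin> C"
  proof
    assume "x \<in> C"
    moreover have "x \<in> W1" using W(2) W1(2) dvd_refl[of x] by blast
    then have "x \<in> vs.span (W1 \<union> (C - {x}))" by (intro vs.span_base) auto
    ultimately show False using C unfolding quotient_basis_def by blast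
  qed
  define I :: "('r + 'n \<times> 'n) set" where "I = insert x C <+> P"
  have "finite I" using \<open>finite C\<close> \<open>finite P\<close> by (simp add: I_def)
  have "card E \<le> card B + 1 + card C"
    unfolding E_def using card_Un_le[of "insert 1 B" C] card_insert_le_m1[of "card B + 1" B 1] by simp
  moreover have "card I = card C + 1 + card P"
    using \<open>finite C\<close> \<open>finite P\<close> \<open>x \<notin> C\<close> by (simp add: I_def card_Plus)
  ultimately have "card E < card I" using card_P by linarith
  \<comment> \<open>For \<open>x\<close> the lift is \<open>X\<close>, so that its linear
    coefficients are \<open>lin\<close>.\<close>
  define lift where "lift r = (if r = x then X else SOME p. \<phi> p = r)" for r
  have lift: "\<phi> (lift r) = r" for r
  proof -
    obtain p where "\<phi> p = r" by (rule phi_surj)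
    then have "\<phi> (SOME p. \<phi> p = r) = r" by (rule someI)
    then show ?thesis by (simp add: lift_def X(2))
  qed
  define w :: "'r + 'n \<times> 'n \<Rightarrow> 'r ^ 'n" where
    "w j = (case j of Inl r \<Rightarrow> grad (lift r) | Inr (a, b) \<Rightarrow> axis a (\<phi> (mfps_var b)))" for j
  have "\<exists>\<beta> v. (\<exists>j\<in>I. \<beta> j \<noteq> 0) \<and> (\<Sum>j\<in>I. \<iota> (\<beta> j) *s w j) - x *s v \<in> N"
    by (rule torsion_free_dependent[OF _ E E_span \<open>finite I\<close> \<open>card E < card I\<close>]) (rule tf)
  then obtain \<beta> v
    where \<beta>: "\<exists>j\<in>I. \<beta> j \<noteq> 0" "(\<Sum>j\<in>I. \<iota> (\<beta> j) *s w j) - x *s v \<in> N"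
    by blast
  \<comment> \<open>The element of \<open>N\<close> is the gradient of a kernel element
    \<open>F\<close>; the independence result is then applied to \<open>g0 - F\<close>.\<close>
  obtain F where F: "\<phi> F = 0" "(\<Sum>j\<in>I. \<iota> (\<beta> j) *s w j) - x *s v = grad F"
    using \<beta>(2) N_eq by blast
  define g0 where "g0 = (\<Sum>r\<in>insert x C. mfps_const (\<beta> (Inl r)) * lift r)"
  define \<Gamma> where "\<Gamma> a b = (if (a, b) \<in> P then \<beta> (Inr (a, b)) else 0)" for a b
  have sum_I: "(\<Sum>j\<in>I. \<iota> (\<beta> j) *s w j) =
      grad g0 + (\<Sum>(a, b)\<in>P. \<iota> (\<beta> (Inr (a, b))) *s axis a (\<phi> (mfps_var b)))"
    using \<open>finite C\<close> \<open>finite P\<close>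
    by (simp only: I_def sum.Plus finite_insert w_def g0_def grad_sum grad_simps sum.case case_prod_unfold
        sum.simps o_def) simp
  have "\<phi> (mfps_pderiv i (g0 - F)) + (\<Sum>j\<in>UNIV. \<iota> (\<Gamma> i j) * \<phi> (mfps_var j)) = x * v $ i" for i
  proof -
    have "(\<Sum>(a, b)\<in>P. \<iota> (\<beta> (Inr (a, b))) *s axis a (\<phi> (mfps_var b))) $ i =
        (\<Sum>(a, b)\<in>P. if a = i then \<iota> (\<Gamma> i b) * \<phi> (mfps_var b) else 0)"
      unfolding sum_component by (intro sum.cong) (auto simp: axis_def \<Gamma>_def)
    also have "\<dots> = (\<Sum>(a, b)\<in>UNIV. if a = i then \<iota> (\<Gamma> i b) * \<phi> (mfps_var b) else 0)"
      by (intro sum.mono_neutral_left) (auto simp: \<Gamma>_def)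
    also have "\<dots> = (\<Sum>j\<in>UNIV. \<iota> (\<Gamma> i j) * \<phi> (mfps_var j))"
      unfolding UNIV_Times_UNIV[symmetric] sum.cartesian_product[symmetric]
      by (subst sum.swap) simp
    finally have "(\<Sum>j\<in>UNIV. \<iota> (\<Gamma> i j) * \<phi> (mfps_var j)) =
        (\<Sum>(a, b)\<in>P. \<iota> (\<beta> (Inr (a, b))) *s axis a (\<phi> (mfps_var b))) $ i" by (rule sym)
    moreover have "grad g0 $ i + (\<Sum>(a, b)\<in>P. \<iota> (\<beta> (Inr (a, b))) *s axis a (\<phi> (mfps_var b))) $ i
        - x * v $ i = grad F $ i"
      using arg_cong[OF F(2)[unfolded sum_I], of "\<lambda>y. y $ i"] by simp
    ultimately show ?thesis by (simp add: grad_def algebra_simps)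
  qed
  note core = differentials_independent_mod_x[OF o _ _ _ this W]
  have \<Gamma>: "\<Gamma> i o' = 0" "\<Gamma> o' j = 0" "\<Gamma> i j = 0 \<or> \<Gamma> j i = 0" for i j
    by (auto simp: \<Gamma>_def P_def A_def)
  have "\<beta> (Inr p) = 0" if "p \<in> P" for p
    using core(1)[OF \<Gamma>, of "fst p" "snd p"] that by (simp add: \<Gamma>_def)
  \<comment> \<open>The image of \<open>g0 - F\<close> is constant modulo \<open>W\<close>. The
    constant and the multiple of \<open>x\<close> lie in \<open>W1\<close>, which leaves a relation
    among the elements of \<open>C\<close>.\<close>
  moreover have \<beta>C: "\<beta> (Inl r) = 0" if "r \<in> C" for r
  proof (rule vs.quotient_basis_independent[OF C W1(1) \<open>finite C\<close> order.refl _ that])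
    let ?c = "mfps_coeff (g0 - F) 0"
    have "\<phi> (g0 - F) - \<iota> ?c \<in> W1" using core(3)[OF \<Gamma>] W1(2) by blast
    moreover have "alg_scale \<iota> ?c 1 \<in> W1" using W1 by (intro vs.subspace_scale)
    ultimately have "\<phi> (g0 - F) - \<iota> ?c + alg_scale \<iota> ?c 1 \<in> W1" by (rule vs.subspace_add[OF W1(1)])
    then have "\<phi> g0 \<in> W1" using F(1) by (simp add: alg_scale_def)
    moreover have "x * \<iota> (\<beta> (Inl x)) \<in> W1" using W(2) W1(2) dvd_triv_left by blast
    ultimately have "\<phi> g0 - x * \<iota> (\<beta> (Inl x)) \<in> W1" by (rule vs.subspace_diff[OF W1(1)])
    moreover have "\<phi> g0 = x * \<iota> (\<beta> (Inl x)) + (\<Sum>r\<in>C. alg_scale \<iota> (\<beta> (Inl r)) r)"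
      using \<open>finite C\<close> \<open>x \<notin> C\<close> by (simp add: g0_def phi_sum lift alg_scale_def mult.commute)
    ultimately show "(\<Sum>r\<in>C. alg_scale \<iota> (\<beta> (Inl r)) r) \<in> W1" by simp
  qed
  \<comment> \<open>Only the term of \<open>x\<close> is left in \<open>g0\<close>, with linear
    coefficient \<open>\<beta> (Inl x) * lin o'\<close> at \<open>o'\<close>.\<close>
  moreover have "\<beta> (Inl x) = 0"
  proof -
    have "g0 = mfps_const (\<beta> (Inl x)) * X"
      using \<open>finite C\<close> \<open>x \<notin> C\<close> \<beta>C by (simp add: g0_def const_simps lift_def)
    moreover have "mfps_coeff F (axis o' 1) = 0"
    proof -
      have "mdeg (axis o' 1 :: nat ^ 'n) < 2" by simp
      then show ?thesis using ker_phi_order[OF F(1)] unfolding order_ge_def by blast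
    qed
    ultimately have "\<beta> (Inl x) * lin o' = 0"
      using core(2)[OF \<Gamma>, of o'] by (simp add: lin_def)
    then show ?thesis using o by simp
  qed
  ultimately show False using \<beta>(1) by (auto simp: I_def)
qed

text \<open>The coset of \<open>v\<close> is the nonzero torsion element: \<open>coker_scale\<close>
  makes its multiple by \<open>r\<close> a union of cosets, each equal to \<open>N\<close>
  here.\<close>

lemma differentials_torsion_nonzero:
  assumes "r \<noteq> 0" "r *s v \<in> N" "v \<notin> N"
  shows "differentials_torsion \<phi> f \<noteq> {coker_zero J}"
proof
  assume eq: "differentials_torsion \<phi> f = {coker_zero J}"
  have "(r *s u) +o N = N" if vu: "u \<in> v +o N" for u
  proof -
    obtain w where "w \<in> N" "u = v + w" using vu by (auto simp: elt_set_plus_def)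
    then have u: "r *s u \<in> N" using assms(2) by (simp add: vector_add_ldistrib N_add N_smult)
    have "z \<in> (r *s u) +o N" if "z \<in> N" for z
      using N_diff[OF that u] unfolding elt_set_plus_def by (auto intro!: bexI[of _ "z - r *s u"])
    then show ?thesis using u by (auto simp: elt_set_plus_def N_add)
  qed
  moreover have "v \<in> v +o N" using N_0 unfolding elt_set_plus_def by force
  ultimately have "(\<Union>u\<in>v +o N. (r *s u) +o N) = N" by blast
  then have "coker_scale J r (v +o N) = coker_zero J"
    by (simp add: coker_scale_def coker_zero_def N_def)
  moreover have "v +o N \<in> coker J" unfolding coker_def N_def by blast
  ultimately have "v +o N \<in> differentials_torsion \<phi> f"
    using assms(1) unfolding differentials_torsion_def coker_torsion_def by blast
  then have "v +o N = N" unfolding eq coker_zero_def N_def by simp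
  then show False using \<open>v \<in> v +o N\<close> assms(3) by blast
qed

section \<open>Dimension bounds modulo \<open>x\<close> from the conductor and from the
  socle\<close>

lemma quotient_basis_mod_x_finite:
  assumes "quotient_basis (alg_scale \<iota>) V W B" "vs.subspace W" "{r. x dvd r} \<subseteq> W"
  shows "finite B"
proof -
  obtain F where F: "finite F" "UNIV \<subseteq> vs.span ({r. x dvd r} \<union> F)" using finite_span_mod_x by blast
  have "vs.span ({r. x dvd r} \<union> F) \<subseteq> vs.span (W \<union> F)" by (rule vs.span_mono) (use assms in auto)
  then have "V \<subseteq> vs.span (W \<union> F)" using F(2) by blast
  then show ?thesis using vs.quotient_basis_finite assms(1,2) F(1) by blast
qed

lemma subspace_dvd: "vs.subspace {r. y dvd r}"
  by (auto simp: vs.subspace_def alg_scale_def)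

text \<open>Applied with \<open>A\<close> equal to \<open>m\<close> for socles, and to the products
  of two elements of \<open>m\<close> for \<open>(x) : m^2\<close>.\<close>

lemma subspace_colon: "vs.subspace {r. \<forall>a\<in>A. y dvd a * r}"
proof -
  have "y dvd a * (\<iota> c * r)" if "y dvd a * r" for a c r
    using dvd_mult[OF that, of "\<iota> c"] by (simp only: mult.left_commute)
  then show ?thesis by (auto simp: vs.subspace_def alg_scale_def distrib_left)
qed

lemma torsion_of_conductor_bound:
  assumes m4: "ideal_power m 4 \<subseteq> ideal_gen (insert x conductor_ideal)"
    and card: "2 * (reduced_type \<iota> x + 1) \<le> (CARD('n) - 1) * (CARD('n) - 2)"
  shows "\<exists>r v. r \<noteq> 0 \<and> r *s v \<in> N \<and> v \<notin> N"
proof -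
  let ?W = "ideal_gen (insert x conductor_ideal)"
  \<comment> \<open>The same choice as in \<open>quotient_dim\<close>, so that \<open>card B\<close>
    is the reduced type by unfolding.\<close>
  define B where "B = (SOME B. quotient_basis (alg_scale \<iota>) ?W {r. x dvd r} B)"
  have W: "vs.subspace ?W" by (intro ideal_subspace ring_module.subspace_span)
  have xW: "{r. x dvd r} \<subseteq> ?W"
    unfolding ideal_gen_singleton[symmetric] by (rule ring_module.span_mono) simp
  have B: "quotient_basis (alg_scale \<iota>) ?W {r. x dvd r} B"
    unfolding B_def by (rule someI_ex[OF vs.quotient_basis_exists[OF W subspace_dvd xW]])
  have "reduced_type \<iota> x = card B"
    by (simp add: reduced_type_def quotient_dim_def B_def ideal_gen_singleton)
  moreover have "finite B" by (rule quotient_basis_mod_x_finite[OF B subspace_dvd order.refl])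
  moreover have "?W \<subseteq> vs.span ({r. x dvd r} \<union> B)" using B unfolding quotient_basis_def by blast
  ultimately show ?thesis using torsion_of_codimension_bound[OF W xW m4] card by simp
qed

text \<open>Multiplication by \<open>x / y\<close> transports the socle from the quotient by \<open>y\<close> to that by \<open>x\<close>.\<close>

lemma gorenstein_socle:
  assumes "gorenstein \<iota> m"
  shows "\<exists>\<tau>. {r. \<forall>a\<in>m. x dvd a * r} \<subseteq> vs.span ({r. x dvd r} \<union> {\<tau>})"
proof -
  obtain y where y: "y \<in> m" "y \<noteq> 0" "cm_type \<iota> m y = 1" using assms unfolding gorenstein_def by blast
  let ?S = "{r. \<forall>a\<in>m. y dvd a * r}"
  define B where "B = (SOME B. quotient_basis (alg_scale \<iota>) ?S {r. y dvd r} B)"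
  have B: "quotient_basis (alg_scale \<iota>) ?S {r. y dvd r} B"
    unfolding B_def
    by (intro someI_ex[OF vs.quotient_basis_exists] subspace_dvd subspace_colon) auto
  have "card B = 1" using y(3) by (simp add: cm_type_def quotient_dim_def B_def ideal_gen_singleton)
  then obtain \<sigma> where \<sigma>: "B = {\<sigma>}" by (auto simp: card_1_singleton_iff)
  have "\<sigma> \<in> ?S" using B \<sigma> unfolding quotient_basis_def by blast
  moreover have x: "x \<in> m" using reduction by (simp add: minimal_reduction_def)
  \<comment> \<open>\<open>\<tau>\<close> is \<open>x \<sigma> / y\<close>, an element of
    \<open>R\<close> because \<open>x\<close> is in \<open>m\<close> and \<open>\<sigma>\<close> is
    in the socle modulo \<open>y\<close>.\<close>
  ultimately obtain \<tau> where \<tau>: "x * \<sigma> = y * \<tau>" by (auto elim: dvdE)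
  have "r \<in> vs.span ({r. x dvd r} \<union> {\<tau>})" if r: "\<forall>a\<in>m. x dvd a * r" for r
  proof -
    obtain r' where r': "y * r = x * r'" using r y(1) by (auto elim: dvdE)
    have "y dvd a * r'" if "a \<in> m" for a
    proof -
      have "x * y dvd y * (a * r)" using r that by (simp add: mult.commute[of x] mult_dvd_mono)
      also have "y * (a * r) = x * (a * r')" using r' by (metis mult.left_commute)
      finally show ?thesis using x_nonzero by simp
    qed
    then have "r' \<in> vs.span ({r. y dvd r} \<union> {\<sigma>})" using B \<sigma> unfolding quotient_basis_def by blast
    then obtain c where "y dvd r' - alg_scale \<iota> c \<sigma>"
      using vs.span_finite_subspace_Un[OF subspace_dvd, of "{\<sigma>}"] by auto
    then obtain t where t: "r' = alg_scale \<iota> c \<sigma> + y * t" by (metis add.commute diff_add_cancel dvdE)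
    have "y * r = y * (\<iota> c * \<tau> + x * t)"
      using r' t \<tau> by (simp add: alg_scale_def distrib_left)
    then have "r = x * t + alg_scale \<iota> c \<tau>" using y(2) by (simp add: alg_scale_def)
    then show ?thesis by (auto intro!: vs.span_add vs.span_scale intro: vs.span_base)
  qed
  then show ?thesis by blast
qed

text \<open>Multiplication by the variables embeds \<open>((x) : m^2) / ((x) : m)\<close> into one
  copy of the socle of \<open>R/(x)\<close> for each variable. The socle is spanned by
  \<open>\<tau>\<close>, which adds one more dimension.\<close>

lemma torsion_of_gorenstein:
  assumes m6: "ideal_power m 6 \<subseteq> ideal_gen {x}" and "gorenstein \<iota> m"
    and card: "2 * (CARD('n) + 2) \<le> (CARD('n) - 1) * (CARD('n) - 2)"
  shows "\<exists>r v. r \<noteq> 0 \<and> r *s v \<in> N \<and> v \<notin> N"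
proof -
  let ?S = "{r. \<forall>a\<in>m. x dvd a * r}"
  let ?W = "{r. \<forall>a\<in>m. \<forall>b\<in>m. x dvd a * (b * r)}"
  obtain \<tau> where \<tau>: "?S \<subseteq> vs.span ({r. x dvd r} \<union> {\<tau>})" using gorenstein_socle assms(2) by blast
  have S: "vs.subspace ?S" by (rule subspace_colon)
  have "?W = {r. \<forall>d\<in>{a * b | a b. a \<in> m \<and> b \<in> m}. x dvd d * r}"
    by (auto simp: mult.assoc[symmetric])
  then have W: "vs.subspace ?W" by (simp only: subspace_colon)
  have SW: "?S \<subseteq> ?W" by auto
  have xS: "{r. x dvd r} \<subseteq> ?S" by auto
  obtain B where B: "quotient_basis (alg_scale \<iota>) ?W ?S B"
    using vs.quotient_basis_exists[OF W S SW] by blast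
  have var_m: "\<phi> (mfps_var i) \<in> m" for i using var_in_order_ge m_eq by blast
  \<comment> \<open>Coordinates of \<open>u\<close>: its product with the variable \<open>i\<close>
    is in the socle, hence a multiple of \<open>\<tau>\<close> modulo \<open>x\<close>.\<close>
  define c where "c u i = (SOME c. x dvd \<phi> (mfps_var i) * u - \<iota> c * \<tau>)" for u i
  have c: "x dvd \<phi> (mfps_var i) * u - \<iota> (c u i) * \<tau>" if u: "u \<in> ?W" for u i
  proof -
    have "\<phi> (mfps_var i) * u \<in> ?S" using u var_m by blast
    then have "\<phi> (mfps_var i) * u \<in> vs.span ({r. x dvd r} \<union> {\<tau>})" using \<tau> by blast
    then have "\<exists>c. x dvd \<phi> (mfps_var i) * u - \<iota> c * \<tau>"
      using vs.span_finite_subspace_Un[OF subspace_dvd, of "{\<tau>}"] by (auto simp: alg_scale_def)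
    then show ?thesis unfolding c_def by (rule someI_ex)
  qed
  have "finite B \<and> card B \<le> card (UNIV :: 'n set)"
  proof (rule vs.quotient_basis_card_le[OF B S finite])
    fix A d assume A: "finite A" "A \<subseteq> ?W" "\<forall>i\<in>UNIV. (\<Sum>b\<in>A. d b * c b i) = 0"
    let ?s = "\<Sum>b\<in>A. alg_scale \<iota> (d b) b"
    have var_s: "x dvd \<phi> (mfps_var i) * ?s" for i
    proof -
      have "(\<Sum>b\<in>A. \<iota> (d b) * (\<phi> (mfps_var i) * b - \<iota> (c b i) * \<tau>)) =
          \<phi> (mfps_var i) * ?s - \<iota> (\<Sum>b\<in>A. d b * c b i) * \<tau>"
        by (simp add: alg_scale_def right_diff_distrib sum_subtractf sum_distrib_left
            sum_distrib_right iota_sum mult_ac)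
      also have "\<dots> = \<phi> (mfps_var i) * ?s" using A(3) by simp
      finally have eq: "\<phi> (mfps_var i) * ?s =
          (\<Sum>b\<in>A. \<iota> (d b) * (\<phi> (mfps_var i) * b - \<iota> (c b i) * \<tau>))" by (rule sym)
      have "x dvd \<iota> (d b) * (\<phi> (mfps_var i) * b - \<iota> (c b i) * \<tau>)" if "b \<in> A" for b
        by (rule dvd_mult, rule c) (use A(2) that in blast)
      then show ?thesis unfolding eq by (rule dvd_sum)
    qed
    have "x dvd a * ?s" if a: "a \<in> m" for a
    proof -
      obtain p where p: "p \<in> order_ge (Suc 0)" "a = \<phi> p" using a m_eq by blast
      obtain q where "p = (\<Sum>i\<in>UNIV. mfps_var i * q i)"
        using order_ge_Suc_decompose[OF p(1)] by blast
      then have "a * s = (\<Sum>i\<in>UNIV. \<phi> (q i) * (\<phi> (mfps_var i) * s))" for s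
        by (simp add: p(2) phi_sum sum_distrib_left mult_ac)
      then show ?thesis using var_s by (simp only: dvd_sum dvd_mult)
    qed
    then show "?s \<in> ?S" by blast
  qed
  then have "finite B" "card B \<le> CARD('n)" by simp_all
  moreover have "?W \<subseteq> vs.span ({r. x dvd r} \<union> insert \<tau> B)"
  proof -
    let ?U = "vs.span ({r. x dvd r} \<union> insert \<tau> B)"
    have "vs.span ({r. x dvd r} \<union> {\<tau>}) \<subseteq> ?U" by (rule vs.span_mono) auto
    then have "?S \<subseteq> ?U" using \<tau> by blast
    moreover have "B \<subseteq> ?U" using vs.span_superset[of "{r. x dvd r} \<union> insert \<tau> B"] by blast
    ultimately have "vs.span (?S \<union> B) \<subseteq> ?U" by (intro vs.span_minimal) auto
    then show ?thesis using B unfolding quotient_basis_def by blast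
  qed
  moreover have "ideal_power m 4 \<subseteq> ?W"
  proof safe
    fix r a b assume "r \<in> ideal_power m 4" "a \<in> m" "b \<in> m"
    then have "a * (b * r) \<in> ideal_power m (Suc (Suc 4))" by (simp only: ideal_power.simps ideal_multI)
    then have "a * (b * r) \<in> ideal_power m 6" by simp
    then show "x dvd a * (b * r)" using m6 by (auto simp: ideal_gen_singleton)
  qed
  moreover have "card (insert \<tau> B) \<le> card B + 1" using card_insert_le_m1[of "card B + 1" B \<tau>] by simp
  ultimately show ?thesis
    using torsion_of_codimension_bound[OF W _ _ _ , of "insert \<tau> B"] xS SW card by auto
qed

end

text \<open>Both sides of Berger's equivalence turn out false: the embedding dimension exceeds the
  Krull dimension one, and there is torsion.\<close>

theorem theorem1:
  fixes \<iota> :: "'k::{alg_closed_field, field_char_0} \<Rightarrow> 'r::idom"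
    and m :: "'r set"
    and x :: 'r
    and n :: nat
    and \<phi> :: "('k, 'n::finite) mfps \<Rightarrow> 'r"
    and f :: "('k, 'n) mfps ^ 'm::finite"
  assumes "ring_homomorphism \<iota>"
    and "noetherian_ring TYPE('r)"
    and "local_ring m"
    and "residue_field_is \<iota> m"
    and "adically_complete m"
    and "krull_dim TYPE('r) = 1"
    and "minimal_reduction x m"
    and "n = embedding_dim m"
    and "CARD('n) = n"
    and "presentation \<iota> \<phi> f"
  shows "(ideal_power m 4 \<subseteq> ideal_gen (insert x conductor_ideal) \<and>
            2 * int (reduced_type \<iota> x) \<le> int n * (int n - 3)
          \<longrightarrow> berger_conjecture m \<phi> f) \<and>
         (ideal_power m 6 \<subseteq> ideal_gen {x} \<and> n \<ge> 6 \<and> gorenstein \<iota> m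
          \<longrightarrow> berger_conjecture m \<phi> f)"
proof -
  interpret presented_curve \<iota> m x \<phi> f
    by standard (use assms in auto)
  have berger: "berger_conjecture m \<phi> f"
    if "n > 1" "\<exists>r v. r \<noteq> 0 \<and> r *s v \<in> N \<and> v \<notin> N"
  proof -
    have "enat (embedding_dim m) \<noteq> krull_dim TYPE('r)"
      using that(1) assms(6,8) by (simp add: one_enat_def)
    then have "\<not> regular_local_ring m" unfolding regular_local_ring_def .
    moreover have "differentials_torsion \<phi> f \<noteq> {coker_zero J}"
      using that(2) differentials_torsion_nonzero by blast
    ultimately show ?thesis unfolding berger_conjecture_def by blast
  qed
  have "n > 0" using assms(9) by (metis zero_less_card_finite)
  show ?thesis
  proof (intro conjI impI)
    assume *: "ideal_power m 4 \<subseteq> ideal_gen (insert x conductor_ideal) \<and>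
      2 * int (reduced_type \<iota> x) \<le> int n * (int n - 3)"
    \<comment> \<open>For \<open>n\<close> equal to \<open>1\<close> or \<open>2\<close> the integer
      \<open>n (n - 3)\<close> is negative.\<close>
    have "n \<ge> 3"
    proof (rule ccontr)
      assume "\<not> n \<ge> 3"
      then have "n = 1 \<or> n = 2" using \<open>n > 0\<close> by auto
      then show False using * by auto
    qed
    then obtain k where n: "n = 3 + k" using le_Suc_ex by blast
    have "2 * int (reduced_type \<iota> x) \<le> int ((3 + k) * k)" using * by (simp add: n)
    then have "2 * reduced_type \<iota> x \<le> (3 + k) * k" by linarith
    \<comment> \<open>This uses \<open>n (n - 3) + 2 = (n - 1) (n - 2)\<close>.\<close>
    then have "2 * (reduced_type \<iota> x + 1) \<le> (CARD('n) - 1) * (CARD('n) - 2)"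
      unfolding assms(9) n by (simp add: algebra_simps)
    then show "berger_conjecture m \<phi> f" using berger torsion_of_conductor_bound * \<open>n \<ge> 3\<close> by simp
  next
    assume *: "ideal_power m 6 \<subseteq> ideal_gen {x} \<and> n \<ge> 6 \<and> gorenstein \<iota> m"
    then obtain k where n: "n = 6 + k" using le_Suc_ex by blast
    \<comment> \<open>Equivalent to \<open>0 \<le> n^2 - 5 n - 2\<close>, which holds from
      \<open>n = 6\<close> on and fails at \<open>n = 5\<close>.\<close>
    have "2 * (CARD('n) + 2) \<le> (CARD('n) - 1) * (CARD('n) - 2)"
      unfolding assms(9) n by (simp add: algebra_simps)
    then show "berger_conjecture m \<phi> f" using berger torsion_of_gorenstein * by simp
  qed
qed

end
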